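(* Let $f:\mathbb{R}^n\rightarrow[0,+\infty)$ be a log-concave function such that $0<\int_{\mathbb{R}^n} f<\infty$. Let $H$ be an affine hyperplane in $\mathbb{R}^n$ and let $H_+$ and $H_-$ denote the two closed half-spaces bounded by $H$. If $\lambda\in(0,1)$ satisfies $\lambda\int_{\mathbb{R}^n}f=\int_{H_+}f$, then there exists $z\in H$ such that $$\int_{\mathbb{R}^n}f\int_{\mathbb{R}^n}f^z\leq\frac{1}{4\lambda(1-\lambda)}(2\pi)^n.$$
   Context: A function $\phi:\mathbb{R}^n\to\mathbb{R}\cup\{+\infty\}$ is called convex if it is not identically $+\infty$ and $\phi(\alpha x+(1-\alpha)y)\le\alpha\phi(x)+(1-\alpha)\phi(y)$ for all $x,y\in\mathbb{R}^n$ and $0\le\alpha\le1$. A function $f:\mathbb{R}^n\to[0,\infty)$ is log-concave if $f=e^{-\phi}$ with $\phi$ convex in this sense (with $e^{-\infty}=0$). For a log-concave $f$ and $z\in\mathbb{R}^n$, the polar of $f$ with respect to $z$ is $f^{z}(y)=\inf_{x\in\mathbb{R}^n}\frac{e^{-\langle x-z,y-z\rangle}}{f(x)}$, where the quotient is $+\infty$ when $f(x)=0$. Integrals are with respect to Lebesgue measure. *)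

theory Defs
  imports "HOL-Analysis.Analysis"
begin

(* Values lie in R \<union> {+\<infinity>}, hence the exclusion of -\<infinity>. The ereal convention 0 * \<infinity> = 0
   matters only for \<alpha> = 0 and \<alpha> = 1, where the inequality then reads \<phi> y \<le> \<phi> y, \<phi> x \<le> \<phi> x. *)
definition convex_ereal :: "('a::real_vector \<Rightarrow> ereal) \<Rightarrow> bool" where
  "convex_ereal \<phi> \<longleftrightarrow>
     (\<forall>x. \<phi> x \<noteq> -\<infinity>) \<and> (\<exists>x. \<phi> x \<noteq> \<infinity>) \<and>
     (\<forall>x y (\<alpha>::real). 0 \<le> \<alpha> \<longrightarrow> \<alpha> \<le> 1 \<longrightarrow>
        \<phi> (\<alpha> *\<^sub>R x + (1 - \<alpha>) *\<^sub>R y) \<le> ereal \<alpha> * \<phi> x + ereal (1 - \<alpha>) * \<phi> y)"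

definition log_concave :: "('a::real_vector \<Rightarrow> real) \<Rightarrow> bool" where
  "log_concave f \<longleftrightarrow>
     (\<exists>\<phi>. convex_ereal \<phi> \<and>
        (\<forall>x. f x = (if \<phi> x = \<infinity> then 0 else exp (- real_of_ereal (\<phi> x)))))"

(* Division in ennreal gives c / 0 = \<infinity> for c > 0, so points with f x = 0 do not affect the infimum. *)
definition polar_at :: "('a::real_inner \<Rightarrow> real) \<Rightarrow> 'a \<Rightarrow> 'a \<Rightarrow> ennreal" where
  "polar_at f z y = (INF x. ennreal (exp (- ((x - z) \<bullet> (y - z)))) / ennreal (f x))"

end

theory Submission
  imports Defs "HOL-Probability.Distributions" "HOL-Probability.Distribution_Functions"
begin

text \<open>
  The proof goes by induction on the dimension, following Lehec, and uses only the Prekopa--Leindler inequality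
  on the line.

  In dimension one, a dual pair on two half-lines, \<open>\<phi> s * \<psi> t \<le> exp (- s * t)\<close> for positive \<open>s\<close>
  and \<open>t\<close>, satisfies an inequality of Santalo type with constant \<open>pi / 2\<close> (\<open>half_line_santalo\<close>): the
  substitution of exponentials turns products into sums, and the Prekopa--Leindler inequality applies.

  Let \<open>f\<close> be a weight in dimension \<open>n\<close> that is cut by a hyperplane into two parts of positive mass. The
  segment between the barycenters of the two parts meets the hyperplane in a point \<open>z\<close>; this is the required
  point. To see this, integrate \<open>f\<close> on one side of the hyperplane along the direction of the segment, and integrate
  a function \<open>g\<close> that is dual to \<open>f\<close> with respect to \<open>z\<close> along the dual direction. By the inequality on
  half-lines, the results are, up to the factor \<open>pi / 2\<close>, a dual pair in dimension \<open>n - 1\<close>, and by the choice of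
  the segment the first of them has its barycenter at \<open>z\<close>. If the Santalo inequality
  for centered weights is known in dimension \<open>n - 1\<close>, the product of the integral of \<open>f\<close> over this side and of
  that of \<open>g\<close> over a matching half-space is at most \<open>(2 * pi) ^ n / 4\<close> (\<open>half_space_santalo\<close>). The two
  half-spaces that arise for \<open>g\<close> cover the space, so that adding the two bounds for \<open>g\<close> gives
  the factor \<open>1 / (4 * lam * (1 - lam))\<close> (\<open>coordinate_hyperplane_santalo\<close>).

  Conversely, the hyperplane inequality in dimension \<open>n\<close> with \<open>lam = 1 / 2\<close> implies the Santalo inequality for
  centered weights in the same dimension (\<open>centered_santalo_insert\<close>). For a dual pair \<open>f\<close>, \<open>g\<close> with \<open>f\<close>
  centered, apply it to \<open>g\<close> and to a hyperplane that halves \<open>g\<close>. It yields a point \<open>z\<close> and bounds the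
  integral of \<open>f\<close> multiplied by the exponential of the scalar product with \<open>z\<close>. Because \<open>f\<close> is centered, this
  exponential factor does not decrease the integral of \<open>f\<close>. This closes the induction, which starts with
  the one-point space of dimension zero.

  The changes of variables are shears and translations of a product of copies of Lebesgue measure, which preserve it by
  Tonelli's theorem; no determinants occur, and a hyperplane in general position is sheared into one that is orthogonal
  to a coordinate axis (\<open>hyperplane_santalo\<close>). The barycenters exist because a log-concave function with finite
  positive integral has finite first moments (\<open>log_concave_first_moment\<close>).
\<close>

section \<open>The Prekopa-Leindler inequality on the line\<close>

text \<open>
  If the supremum of \<open>A\<close> is attained, \<open>A\<close> is itself an initial segment. Otherwise a sequence in \<open>A\<close>
  increasing to the supremum, possibly infinite, exhausts \<open>A\<close> by initial segments.
\<close>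

lemma emeasure_le_if_initial_segments_le:
  fixes A :: "real set"
  assumes A: "A \<in> sets borel" "A \<noteq> {}"
    and le: "\<And>a. a \<in> A \<Longrightarrow> emeasure lborel (A \<inter> {..a}) \<le> K"
  shows "emeasure lborel A \<le> K"
proof (cases "\<exists>a\<in>A. \<forall>x\<in>A. x \<le> a")
  case True
  then obtain a where a: "a \<in> A" "A \<subseteq> {..a}" by auto
  then have "A \<inter> {..a} = A" by auto
  with le[OF a(1)] show ?thesis by simp
next
  case False
  obtain f :: "nat \<Rightarrow> ereal" where f: "incseq f" "range f \<subseteq> ereal ` A" "Sup (ereal ` A) = (SUP i. f i)"
    using Sup_countable_SUP[of "ereal ` A"] A(2) by auto
  then have "\<forall>i. \<exists>a\<in>A. f i = ereal a" by auto
  then obtain u where u: "\<And>i. u i \<in> A" "\<And>i. f i = ereal (u i)" by metis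
  have mono: "incseq u" using f(1) by (auto simp: incseq_def u(2))
  have "A = (\<Union>i. A \<inter> {..u i})"
  proof -
    have "\<exists>i. x \<le> u i" if x: "x \<in> A" for x
    proof -
      from False x obtain y where "y \<in> A" "x < y" by (meson not_le)
      then have "ereal x < ereal y" "ereal y \<le> Sup (ereal ` A)" by (auto intro: Sup_upper)
      then have "ereal x < Sup (ereal ` A)" by (rule less_le_trans)
      then show ?thesis unfolding f(3) less_SUP_iff u(2) by (auto intro: less_imp_le)
    qed
    then show ?thesis by auto
  qed
  then have "emeasure lborel A = emeasure lborel (\<Union>i. A \<inter> {..u i})" by simp
  also have "\<dots> = (SUP i. emeasure lborel (A \<inter> {..u i}))"
    using A by (intro SUP_emeasure_incseq[symmetric] incseq_SucI Int_mono order_refl)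
      (auto simp: incseq_SucD[OF mono])
  also have "\<dots> \<le> K" using le u by (auto intro!: SUP_least)
  finally show ?thesis .
qed

lemma emeasure_lborel_affine_vimage:
  fixes S :: "real set"
  assumes [measurable]: "S \<in> sets borel" and c: "c \<noteq> 0"
  shows "emeasure lborel S = ennreal \<bar>c\<bar> * emeasure lborel {x. t + c * x \<in> S}"
proof -
  have "emeasure lborel S = (\<integral>\<^sup>+x. indicator S x \<partial>lborel)" by simp
  also have "\<dots> = ennreal \<bar>c\<bar> * (\<integral>\<^sup>+x. indicator S (t + c * x) \<partial>lborel)"
    using c by (intro nn_integral_real_affine) auto
  also have "(\<integral>\<^sup>+x. indicator S (t + c * x) \<partial>lborel) = (\<integral>\<^sup>+x. indicator {x. t + c * x \<in> S} x \<partial>lborel)"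
    by (intro nn_integral_cong) (auto simp: indicator_def)
  also have "\<dots> = emeasure lborel {x. t + c * x \<in> S}" by simp
  finally show ?thesis .
qed

lemma ennreal_le_diff_iff_add_le:
  fixes a b d :: ennreal
  shows "b \<le> d \<Longrightarrow> a \<le> d - b \<longleftrightarrow> a + b \<le> d"
  by (auto simp: ennreal_le_minus_iff)

lemma ennreal_le_of_add_le:
  fixes a b d :: ennreal
  assumes "a + b \<le> d"
  shows "a \<le> d" "b \<le> d"
  by (rule order_trans[OF _ assms]; simp)+

text \<open>
  This is the Brunn--Minkowski inequality on the line. For \<open>a \<in> A\<close> and \<open>b \<in> B\<close> the translates
  \<open>(A \<inter> {..a}) + b\<close> and \<open>a + (B \<inter> {b..})\<close> both lie in \<open>A + B\<close> and overlap in the single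
  point \<open>a + b\<close>, so their measures add up. Letting \<open>a\<close> move up through \<open>A\<close> and then \<open>b\<close> down
  through \<open>B\<close> recovers the full measures.
\<close>

lemma emeasure_midpoint_set:
  fixes A B C :: "real set"
  assumes [measurable]: "A \<in> sets borel" "B \<in> sets borel" "C \<in> sets borel"
    and ne: "A \<noteq> {}" "B \<noteq> {}"
    and mid: "\<And>a b. a \<in> A \<Longrightarrow> b \<in> B \<Longrightarrow> (a + b) / 2 \<in> C"
  shows "emeasure lborel A + emeasure lborel B \<le> 2 * emeasure lborel C"
proof -
  \<comment> \<open>The sumset of A and B is a subset of this dilate of C.\<close>
  define D where "D = {x. x / 2 \<in> C}"
  have [measurable]: "D \<in> sets borel" unfolding D_def by measurable
  have "emeasure lborel D = 2 * emeasure lborel {x. 0 + 2 * x \<in> D}"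
    by (subst emeasure_lborel_affine_vimage[where c=2 and t=0]) auto
  then have D: "emeasure lborel D = 2 * emeasure lborel C" by (simp add: D_def)
  have *: "emeasure lborel (A \<inter> {..a}) + emeasure lborel (B \<inter> {b..}) \<le> emeasure lborel D"
    if ab: "a \<in> A" "b \<in> B" for a b
  proof -
    have "emeasure lborel (A \<inter> {..a}) = emeasure lborel {x. - b + 1 * x \<in> A \<inter> {..a}}"
      by (subst emeasure_lborel_affine_vimage[where c=1 and t="-b"]) auto
    moreover have "emeasure lborel (B \<inter> {b..}) = emeasure lborel {x. - a + 1 * x \<in> B \<inter> {b..}}"
      by (subst emeasure_lborel_affine_vimage[where c=1 and t="-a"]) auto
    moreover have "emeasure lborel {x. - a + 1 * x \<in> B \<inter> {b..}} 
        = emeasure lborel ({x. - a + 1 * x \<in> B \<inter> {b..}} - {a + b})"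
      by (intro emeasure_Diff_null_set[symmetric]) auto
    moreover have "emeasure lborel {x. - b + 1 * x \<in> A \<inter> {..a}}
        + emeasure lborel ({x. - a + 1 * x \<in> B \<inter> {b..}} - {a + b})
      = emeasure lborel ({x. - b + 1 * x \<in> A \<inter> {..a}} \<union> ({x. - a + 1 * x \<in> B \<inter> {b..}} - {a + b}))"
      by (intro plus_emeasure) auto
    moreover have "\<dots> \<le> emeasure lborel D"
    proof (intro emeasure_mono subsetI)
      fix x assume "x \<in> {x. - b + 1 * x \<in> A \<inter> {..a}} \<union> ({x. - a + 1 * x \<in> B \<inter> {b..}} - {a + b})"
      then show "x \<in> D" using mid[OF _ ab(2), of "x - b"] mid[OF ab(1), of "x - a"] by (auto simp: D_def)
    qed simp
    ultimately show ?thesis by simp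
  qed
  have 1: "emeasure lborel A + emeasure lborel (B \<inter> {b..}) \<le> emeasure lborel D" if b: "b \<in> B" for b
  proof -
    obtain a where a: "a \<in> A" using ne by auto
    have Ble: "emeasure lborel (B \<inter> {b..}) \<le> emeasure lborel D"
      using *[OF a b] by (rule ennreal_le_of_add_le)
    have "emeasure lborel A \<le> emeasure lborel D - emeasure lborel (B \<inter> {b..})"
      using ne *[OF _ b] by (intro emeasure_le_if_initial_segments_le[OF _ _ ennreal_le_diff_iff_add_le[OF Ble, THEN iffD2]]) simp_all
    then show ?thesis by (simp add: ennreal_le_diff_iff_add_le[OF Ble])
  qed
  obtain b where b: "b \<in> B" using ne by auto
  have Ale: "emeasure lborel A \<le> emeasure lborel D"
    using 1[OF b] by (rule ennreal_le_of_add_le)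
  have B': "emeasure lborel B = emeasure lborel {x. 0 + (-1) * x \<in> B}"
    by (subst emeasure_lborel_affine_vimage[where c="-1" and t=0]) auto
  have "emeasure lborel {x. 0 + (-1) * x \<in> B} \<le> emeasure lborel D - emeasure lborel A"
  proof (rule emeasure_le_if_initial_segments_le)
    show "{x. 0 + (-1) * x \<in> B} \<noteq> {}" 
    proof -
      have "- b \<in> {x. 0 + (-1) * x \<in> B}" using b by simp
      then show ?thesis by blast
    qed
    fix c assume c: "c \<in> {x. 0 + (-1) * x \<in> B}"
    \<comment> \<open>Reflection turns final segments of B into initial segments.\<close>
    have "emeasure lborel (B \<inter> {-c..}) = emeasure lborel {x. 0 + (-1) * x \<in> B \<inter> {-c..}}"
      by (subst emeasure_lborel_affine_vimage[where c="-1" and t=0]) auto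
    also have "{x. 0 + (-1) * x \<in> B \<inter> {-c..}} = {x. 0 + (-1) * x \<in> B} \<inter> {..c}" by auto
    finally show "emeasure lborel ({x. 0 + (-1) * x \<in> B} \<inter> {..c}) \<le> emeasure lborel D - emeasure lborel A"
      using 1[of "-c"] c by (simp add: ennreal_le_diff_iff_add_le[OF Ale] add.commute)
  qed measurable
  then show ?thesis
    unfolding D[symmetric] B' by (simp add: ennreal_le_diff_iff_add_le[OF Ale] add.commute)
qed

lemma nn_integral_layer_cake:
  fixes F :: "real \<Rightarrow> real"
  assumes [measurable]: "F \<in> borel_measurable borel"
  shows "(\<integral>\<^sup>+x. ennreal (F x) \<partial>lborel) = (\<integral>\<^sup>+t. emeasure lborel {x. t < F x} * indicator {0<..} t \<partial>lborel)"
proof -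
  have "ennreal (F x) = emeasure lborel {0<..<F x}" for x
    by (cases "0 \<le> F x") (auto simp: ennreal_neg)
  then have "(\<integral>\<^sup>+x. ennreal (F x) \<partial>lborel) = (\<integral>\<^sup>+x. (\<integral>\<^sup>+t. indicator {0<..<F x} t \<partial>lborel) \<partial>lborel)"
    by simp
  also have "\<dots> = (\<integral>\<^sup>+x. (\<integral>\<^sup>+t. (if 0 < t \<and> t < F x then 1 else 0) \<partial>lborel) \<partial>lborel)"
    by (intro nn_integral_cong) (auto simp: indicator_def)
  also have "\<dots> = (\<integral>\<^sup>+t. (\<integral>\<^sup>+x. (if 0 < t \<and> t < F x then 1 else 0) \<partial>lborel) \<partial>lborel)"
    by (intro lborel_pair.Fubini') measurable
  also have "\<dots> = (\<integral>\<^sup>+t. (\<integral>\<^sup>+x. indicator {x. t < F x} x * indicator {0<..} t \<partial>lborel) \<partial>lborel)"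
    by (intro nn_integral_cong) (auto simp: indicator_def)
  also have "\<dots> = (\<integral>\<^sup>+t. emeasure lborel {x. t < F x} * indicator {0<..} t \<partial>lborel)"
    by (intro nn_integral_cong) (simp add: nn_integral_multc)
  finally show ?thesis .
qed

lemma ennreal_mult_le_square_mean:
  fixes a b c :: ennreal
  assumes "a + b \<le> 2 * c"
  shows "a * b \<le> c ^ 2"
proof (cases "c = \<infinity>")
  case True then show ?thesis by (simp add: power2_eq_square)
next
  case False
  then have fin: "2 * c < \<infinity>" by (simp add: ennreal_mult_less_top less_top)
  have "a < \<infinity>" "b < \<infinity>"
    using assms fin by (auto simp: ennreal_add_eq_top less_top[symmetric] top_unique)
  then obtain x y where [simp]: "a = ennreal x" "b = ennreal y" and nn: "0 \<le> x" "0 \<le> y"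
    by (cases a; cases b) auto
  obtain z where [simp]: "c = ennreal z" and "0 \<le> z"
    using False by (cases c) auto
  note nn = nn this
  have "x + y \<le> 2 * z"
  proof -
    have "ennreal (x + y) \<le> ennreal (2 * z)"
      using assms nn by (simp add: ennreal_mult)
    then show ?thesis using nn by (simp flip: ennreal_plus)
  qed
  then have "(x + y)\<^sup>2 \<le> (2 * z)\<^sup>2" using nn by (intro power_mono) auto
  moreover have "4 * (x * y) \<le> (x + y)\<^sup>2"
    using sum_squares_bound[of x y] by (simp add: power2_sum)
  ultimately have "x * y \<le> z\<^sup>2" by (simp add: power_mult_distrib)
  then show ?thesis using nn by (simp add: ennreal_mult[symmetric] ennreal_power)
qed

text \<open>
  When both suprema are 1, the superlevel sets of \<open>F\<close> and \<open>G\<close> at a common height below 1 are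
  nonempty, and their midpoints lie in the superlevel set of \<open>H\<close> at that height. The inequality
  \<open>emeasure_midpoint_set\<close>, integrated over the heights, bounds the arithmetic mean of the integrals of \<open>F\<close> and \<open>G\<close>,
  which is stronger than bounding their geometric mean.
\<close>

lemma prekopa_leindler_real_normalized:
  fixes F G H :: "real \<Rightarrow> real"
  assumes [measurable]: "F \<in> borel_measurable borel" "G \<in> borel_measurable borel" "H \<in> borel_measurable borel"
    and H: "\<And>x. 0 \<le> H x"
    and F: "\<And>x. F x \<le> 1" "\<And>t. t < 1 \<Longrightarrow> \<exists>x. t < F x"
    and G: "\<And>x. G x \<le> 1" "\<And>t. t < 1 \<Longrightarrow> \<exists>x. t < G x"
    and mid: "\<And>x y. F x * G y \<le> H ((x + y) / 2) ^ 2"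
  shows "(\<integral>\<^sup>+x. ennreal (F x) \<partial>lborel) * (\<integral>\<^sup>+x. ennreal (G x) \<partial>lborel) \<le> (\<integral>\<^sup>+x. ennreal (H x) \<partial>lborel) ^ 2"
proof (rule ennreal_mult_le_square_mean)
  have "emeasure lborel {x. t < F x} * indicator {0<..} t + emeasure lborel {x. t < G x} * indicator {0<..} t
      \<le> 2 * (emeasure lborel {x. t < H x} * indicator {0<..} t)" for t
  proof (cases "0 < t \<and> t < 1")
    case t: True
    have "emeasure lborel {x. t < F x} + emeasure lborel {x. t < G x} \<le> 2 * emeasure lborel {x. t < H x}"
    proof (rule emeasure_midpoint_set)
      fix a b assume "a \<in> {x. t < F x}" "b \<in> {x. t < G x}"
      then have "t * t < F a * G b" using t by (intro mult_strict_mono) auto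
      also have "\<dots> \<le> H ((a + b) / 2) ^ 2" by (rule mid)
      finally have "t\<^sup>2 < (H ((a + b) / 2))\<^sup>2" by (simp add: power2_eq_square)
      then show "(a + b) / 2 \<in> {x. t < H x}" using H by (auto intro: power_less_imp_less_base)
    qed (use F(2) G(2) t in auto)
    then show ?thesis using t by simp
  next
    case False
    then consider "t \<le> 0" | "1 \<le> t" by linarith
    then show ?thesis
    proof cases
      case 2
      then have "\<not> t < F x" "\<not> t < G x" for x
        using F(1)[of x] G(1)[of x] by linarith+
      then show ?thesis by simp
    qed simp
  qed
  then have "(\<integral>\<^sup>+t. emeasure lborel {x. t < F x} * indicator {0<..} t + emeasure lborel {x. t < G x} * indicator {0<..} t \<partial>lborel)
    \<le> (\<integral>\<^sup>+t. 2 * (emeasure lborel {x. t < H x} * indicator {0<..} t) \<partial>lborel)"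
    by (intro nn_integral_mono)
  then show "(\<integral>\<^sup>+x. ennreal (F x) \<partial>lborel) + (\<integral>\<^sup>+x. ennreal (G x) \<partial>lborel) \<le> 2 * (\<integral>\<^sup>+x. ennreal (H x) \<partial>lborel)"
    by (subst (asm) nn_integral_add) (auto simp: nn_integral_layer_cake nn_integral_cmult)
qed

lemma prekopa_leindler_real:
  fixes F G H :: "real \<Rightarrow> real"
  assumes [measurable]: "F \<in> borel_measurable borel" "G \<in> borel_measurable borel" "H \<in> borel_measurable borel"
    and nonneg: "\<And>x. 0 \<le> F x" "\<And>x. 0 \<le> G x" "\<And>x. 0 \<le> H x"
    and bdd: "bdd_above (range F)" "bdd_above (range G)"
    and mid: "\<And>x y. F x * G y \<le> H ((x + y) / 2) ^ 2"
  shows "(\<integral>\<^sup>+x. ennreal (F x) \<partial>lborel) * (\<integral>\<^sup>+x. ennreal (G x) \<partial>lborel) \<le> (\<integral>\<^sup>+x. ennreal (H x) \<partial>lborel) ^ 2"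
proof -
  define a b where "a = Sup (range F)" and "b = Sup (range G)"
  have le: "F x \<le> a" "G x \<le> b" for x unfolding a_def b_def using bdd by (auto intro!: cSup_upper)
  show ?thesis
  proof (cases "0 < a \<and> 0 < b")
    case False
    then have "(\<forall>x. F x = 0) \<or> (\<forall>x. G x = 0)" using le nonneg by (meson antisym not_less order_trans)
    then show ?thesis by auto
  next
    case ab: True
    have near: "\<exists>x. t < F x / a" "\<exists>x. t < G x / b" if "t < 1" for t
    proof -
      have "t * a < Sup (range F)" "t * b < Sup (range G)" using that ab by (auto simp: a_def b_def)
      then show "\<exists>x. t < F x / a" "\<exists>x. t < G x / b"
        using ab bdd by (auto simp: less_cSup_iff field_simps)
    qed
    define s where "s = sqrt (a * b)"
    have s: "s > 0" "s * s = a * b" using ab by (auto simp: s_def)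
    have scale: "(\<integral>\<^sup>+x. ennreal (K x) \<partial>lborel) = ennreal c * (\<integral>\<^sup>+x. ennreal (K x / c) \<partial>lborel)" 
      if "c > 0" and [measurable]: "K \<in> borel_measurable borel" for c and K :: "real \<Rightarrow> real"
      using that by (subst nn_integral_cmult[symmetric]) (auto simp: ennreal_mult'[symmetric])
    have "(\<integral>\<^sup>+x. ennreal (F x / a) \<partial>lborel) * (\<integral>\<^sup>+x. ennreal (G x / b) \<partial>lborel) \<le> (\<integral>\<^sup>+x. ennreal (H x / s) \<partial>lborel) ^ 2"
      (is "?f * ?g \<le> ?h ^ 2")
    proof (rule prekopa_leindler_real_normalized)
      show "F x / a * (G y / b) \<le> (H ((x + y) / 2) / s)\<^sup>2" for x y
        using mid[of x y] ab s by (simp add: power_divide field_simps power2_eq_square)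
    qed (use nonneg le near ab s in auto)
    then have "ennreal (a * b) * (?f * ?g) \<le> ennreal (s * s) * ?h ^ 2"
      unfolding s by (intro mult_left_mono) auto
    moreover have "(\<integral>\<^sup>+x. ennreal (F x) \<partial>lborel) = ennreal a * ?f" "(\<integral>\<^sup>+x. ennreal (G x) \<partial>lborel) = ennreal b * ?g"
      "(\<integral>\<^sup>+x. ennreal (H x) \<partial>lborel) = ennreal s * ?h"
      using ab s by (auto intro!: scale)
    ultimately show ?thesis
      using ab s(1) by (simp add: ennreal_mult power2_eq_square ac_simps)
  qed
qed

section \<open>A Santalo inequality for two half-lines\<close>

lemma nn_integral_half_line_exp_substitution:
  fixes F :: "real \<Rightarrow> real"
  assumes [measurable]: "F \<in> borel_measurable borel"
  shows "(\<integral>\<^sup>+s. ennreal (F s) * indicator {0<..} s \<partial>lborel) = (\<integral>\<^sup>+x. ennreal (F (exp x) * exp x) \<partial>lborel)"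
proof -
  define A where "A n = (\<lambda>s. ennreal (F s) * indicator {exp (- real n)..exp (real n)} s)" for n :: nat
  define B where "B n = (\<lambda>x. ennreal (F (exp x) * exp x) * indicator {- real n..real n} x)" for n :: nat
  have [measurable]: "A n \<in> borel_measurable lborel" "B n \<in> borel_measurable lborel" for n
    unfolding A_def B_def by measurable
  have AB: "integral\<^sup>N lborel (A n) = integral\<^sup>N lborel (B n)" for n
  proof -
    have "(\<integral>\<^sup>+s. ennreal (F s * indicator {exp (- real n)..exp (real n)} s) \<partial>lborel)
        = (\<integral>\<^sup>+x. ennreal (F (exp x) * exp x * indicator {- real n..real n} x) \<partial>lborel)"
      by (rule nn_integral_substitution) (auto intro!: derivative_eq_intros continuous_intros simp: set_borel_measurable_def)
    then show ?thesis
      unfolding A_def B_def by (simp add: ennreal_mult'' ennreal_indicator)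
  qed
  have "(\<lambda>n. integral\<^sup>N lborel (A n)) \<longlonglongrightarrow> (\<integral>\<^sup>+s. ennreal (F s) * indicator {0<..} s \<partial>lborel)"
  proof (rule nn_integral_LIMSEQ)
    show "incseq A" unfolding incseq_def le_fun_def A_def
    proof (intro allI impI mult_left_mono)
      fix m n :: nat and s :: real assume "m \<le> n"
      then have "{exp (- real m)..exp (real m)} \<subseteq> {exp (- real n)..exp (real n)}" by (simp add: atLeastatMost_subset_iff)
      then show "(indicator {exp (- real m)..exp (real m)} s :: ennreal) \<le> indicator {exp (- real n)..exp (real n)} s"
        by (auto simp only: indicator_def of_bool_def zero_le_one split: if_splits)
    qed simp
    fix s
    show "(\<lambda>n. A n s) \<longlonglongrightarrow> ennreal (F s) * indicator {0<..} s"
    proof (cases "s > 0")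
      case True
      obtain N :: nat where N: "\<bar>ln s\<bar> \<le> real N" using real_arch_simple by blast
      have "s \<in> {exp (- real n)..exp (real n)}" if "n \<ge> N" for n
      proof -
        have "- real n \<le> ln s" "ln s \<le> real n" using N that by auto
        then show ?thesis using True by (metis atLeastAtMost_iff exp_le_cancel_iff exp_ln)
      qed
      then have "\<forall>\<^sub>F n in sequentially. A n s = ennreal (F s) * indicator {0<..} s"
        using True by (auto simp: A_def eventually_sequentially intro!: exI[of _ N])
      then show ?thesis by (rule tendsto_eventually)
    next
      case False
      then have "s \<notin> {exp (- real n)..exp (real n)}" for n
        by (metis atLeastAtMost_iff exp_gt_zero less_le_trans)
      then have "A n s = 0" for n by (auto simp: A_def indicator_def)
      then show ?thesis using False by simp
    qed
  qed simp
  moreover have "(\<lambda>n. integral\<^sup>N lborel (B n)) \<longlonglongrightarrow> (\<integral>\<^sup>+x. ennreal (F (exp x) * exp x) \<partial>lborel)"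
  proof (rule nn_integral_LIMSEQ)
    show "incseq B" unfolding incseq_def le_fun_def B_def
      by (intro allI impI mult_left_mono) (auto simp: indicator_def)
    fix x
    obtain N :: nat where N: "\<bar>x\<bar> \<le> real N" using real_arch_simple by blast
    then have "x \<in> {- real n..real n}" if "n \<ge> N" for n using that by auto
    then have "\<forall>\<^sub>F n in sequentially. B n x = ennreal (F (exp x) * exp x)"
      by (auto simp: B_def eventually_sequentially intro!: exI[of _ N])
    then show "(\<lambda>n. B n x) \<longlonglongrightarrow> ennreal (F (exp x) * exp x)" by (rule tendsto_eventually)
  qed simp
  ultimately show ?thesis unfolding AB by (rule LIMSEQ_unique)
qed

lemma nn_integral_half_line_gaussian:
  "(\<integral>\<^sup>+s. ennreal (exp (- s\<^sup>2 / 2)) * indicator {0<..} s \<partial>lborel) = ennreal (sqrt (pi / 2))"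
proof -
  have "(\<integral>\<^sup>+s. ennreal (exp (- s\<^sup>2 / 2)) * indicator {0<..} s \<partial>lborel) 
      = ennreal (sqrt 2) * (\<integral>\<^sup>+x. ennreal (exp (- x\<^sup>2)) * indicator {0<..} x \<partial>lborel)"
    by (subst nn_integral_real_affine[where t=0 and c="sqrt 2"])
      (auto simp: power_mult_distrib indicator_def zero_less_mult_iff intro!: arg_cong[where f="\<lambda>x. _ * x"] nn_integral_cong)
  also have "(\<integral>\<^sup>+x. ennreal (exp (- x\<^sup>2)) * indicator {0<..} x \<partial>lborel) 
      = (\<integral>\<^sup>+x. ennreal (indicator {0..} x *\<^sub>R exp (- x\<^sup>2)) \<partial>lborel)"
    using AE_lborel_singleton[of 0]
    by (intro nn_integral_cong_AE) (auto simp: indicator_def)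
  also have "\<dots> = ennreal (sqrt pi / 2)"
    using gaussian_moment_0 by (subst nn_integral_eq_integral) (auto simp: has_bochner_integral_iff)
  also have "ennreal (sqrt 2) * ennreal (sqrt pi / 2) = ennreal (sqrt (pi / 2))"
  proof -
    have "sqrt (pi / 2) = sqrt 2 * (sqrt pi / 2)"
      by (rule real_sqrt_unique) (auto simp: power_mult_distrib power_divide)
    then show ?thesis by (simp add: ennreal_mult[symmetric])
  qed
  finally show ?thesis .
qed

text \<open>
  With \<open>s = exp x\<close> and \<open>t = exp y\<close> the product \<open>s * t\<close> is the square of the exponential of the midpoint
  of \<open>x\<close> and \<open>y\<close>, so the hypothesis becomes that of the Prekopa--Leindler inequality. The comparison function
  on the right becomes a Gaussian on the half-line, and \<open>pi / 2\<close> is the square of its integral.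
\<close>

lemma half_line_santalo:
  fixes \<phi> \<psi> :: "real \<Rightarrow> ennreal" and C :: real
  assumes [measurable]: "\<phi> \<in> borel_measurable borel" "\<psi> \<in> borel_measurable borel"
    and C: "0 \<le> C"
    and dual: "\<And>s t. 0 < s \<Longrightarrow> 0 < t \<Longrightarrow> \<phi> s * \<psi> t \<le> ennreal (C * exp (- (s * t)))"
  shows "(\<integral>\<^sup>+s. \<phi> s * indicator {0<..} s \<partial>lborel) * (\<integral>\<^sup>+t. \<psi> t * indicator {0<..} t \<partial>lborel) \<le> ennreal (C * (pi / 2))"
proof (cases "(\<exists>s>0. \<phi> s \<noteq> 0) \<and> (\<exists>t>0. \<psi> t \<noteq> 0)")
  case False
  then have "(\<forall>s. \<phi> s * indicator {0<..} s = 0) \<or> (\<forall>t. \<psi> t * indicator {0<..} t = 0)"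
    by (auto simp: indicator_def)
  then show ?thesis by (elim disjE) (simp_all only: nn_integral_const mult_zero_left mult_zero_right zero_le)
next
  case True
  then obtain s0 t0 where s0: "0 < s0" "\<phi> s0 \<noteq> 0" and t0: "0 < t0" "\<psi> t0 \<noteq> 0" by auto
  have fin: "\<phi> s < \<infinity>" "\<psi> s < \<infinity>" if "0 < s" for s
  proof -
    have "\<phi> s * \<psi> t0 < \<infinity>" "\<phi> s0 * \<psi> s < \<infinity>"
      using le_less_trans[OF dual[OF that t0(1)]] le_less_trans[OF dual[OF s0(1) that]] by auto
    then show "\<phi> s < \<infinity>" "\<psi> s < \<infinity>" using s0 t0 by (auto simp: ennreal_mult_less_top)
  qed
  define f g where "f s = enn2real (\<phi> s)" and "g s = enn2real (\<psi> s)" for s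
  have [measurable]: "f \<in> borel_measurable borel" "g \<in> borel_measurable borel"
    unfolding f_def g_def by measurable
  have nn: "0 \<le> f s" "0 \<le> g s" for s by (auto simp: f_def g_def)
  have fg: "\<phi> s = ennreal (f s)" "\<psi> s = ennreal (g s)" if "0 < s" for s
    using fin[OF that] by (auto simp: f_def g_def)
  have dual': "f s * g t \<le> C * exp (- (s * t))" if "0 < s" "0 < t" for s t
    using dual[OF that] C nn by (simp add: fg that ennreal_mult[symmetric])
  define F G where "F x = f (exp x) * exp x" and "G x = g (exp x) * exp x" for x
  define H where "H w = sqrt C * (exp (- (exp w)\<^sup>2 / 2) * exp w)" for w
  have [measurable]: "F \<in> borel_measurable borel" "G \<in> borel_measurable borel" "H \<in> borel_measurable borel"
    unfolding F_def G_def H_def by measurable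
  have FG: "F x * G y \<le> C * (exp (x + y) * exp (- exp (x + y)))" for x y
  proof -
    have "F x * G y = (f (exp x) * g (exp y)) * exp (x + y)" by (simp add: F_def G_def exp_add)
    also have "\<dots> \<le> (C * exp (- (exp x * exp y))) * exp (x + y)"
      by (intro mult_right_mono dual') auto
    finally show ?thesis by (simp add: exp_add[symmetric] ac_simps)
  qed
  have FG': "F x * G y \<le> C" for x y
  proof -
    have "exp (x + y) \<le> exp (exp (x + y))" using exp_ge_add_one_self[of "exp (x + y)"] by linarith
    then have "exp (x + y) * exp (- exp (x + y)) \<le> 1" by (simp add: exp_minus field_simps)
    then have "C * (exp (x + y) * exp (- exp (x + y))) \<le> C" using C by (rule mult_left_le)
    with FG show ?thesis by (rule order_trans)
  qed
  have "F (ln s0) > 0" "G (ln t0) > 0"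
    using s0 t0 fg[OF s0(1)] fg[OF t0(1)] nn[of s0] nn[of t0] by (auto simp: F_def G_def less_le)
  \<comment> \<open>As each of the two functions is positive somewhere, duality bounds the other one.\<close>
  then have "F x \<le> C / G (ln t0)" "G x \<le> C / F (ln s0)" for x
    using FG'[of x "ln t0"] FG'[of "ln s0" x] by (auto simp: field_simps)
  then have bdd: "bdd_above (range F)" "bdd_above (range G)"
    by (auto intro!: bdd_aboveI2[where M="C / G (ln t0)"] bdd_aboveI2[where f=G and M="C / F (ln s0)"])
  have "(\<integral>\<^sup>+x. ennreal (F x) \<partial>lborel) * (\<integral>\<^sup>+x. ennreal (G x) \<partial>lborel) \<le> (\<integral>\<^sup>+x. ennreal (H x) \<partial>lborel) ^ 2"
  proof (rule prekopa_leindler_real)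
    fix x y :: real
    have 1: "(exp ((x + y) / 2))\<^sup>2 = exp (x + y)"
      by (simp only: exp_double[symmetric]) simp
    have 2: "(exp (- u / 2))\<^sup>2 = exp (- u)" for u :: real
      by (simp only: exp_double[symmetric]) simp
    have "(H ((x + y) / 2))\<^sup>2 = C * (exp (x + y) * exp (- exp (x + y)))"
      using C by (simp only: H_def power_mult_distrib 1 2) simp
    then show "F x * G y \<le> (H ((x + y) / 2))\<^sup>2" using FG by simp
  qed (use nn bdd C in \<open>auto simp: F_def G_def H_def\<close>)
  also have "(\<integral>\<^sup>+x. ennreal (H x) \<partial>lborel) = ennreal (sqrt C) * (\<integral>\<^sup>+x. ennreal (exp (- (exp x)\<^sup>2 / 2) * exp x) \<partial>lborel)"
    using C unfolding H_def by (subst nn_integral_cmult[symmetric]) (auto simp: ennreal_mult')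
  also have "\<dots> = ennreal (sqrt C * sqrt (pi / 2))"
    using nn_integral_half_line_exp_substitution[of "\<lambda>s. exp (- s\<^sup>2 / 2)"] C nn_integral_half_line_gaussian
    by (simp add: ennreal_mult)
  also have "\<dots> ^ 2 = ennreal (C * (pi / 2))"
    using C by (simp add: ennreal_power power_mult_distrib)
  finally have *: "(\<integral>\<^sup>+x. ennreal (F x) \<partial>lborel) * (\<integral>\<^sup>+x. ennreal (G x) \<partial>lborel) \<le> ennreal (C * (pi / 2))" .
  have "(\<integral>\<^sup>+s. \<phi> s * indicator {0<..} s \<partial>lborel) = (\<integral>\<^sup>+x. ennreal (F x) \<partial>lborel)"
    unfolding F_def
    by (subst nn_integral_half_line_exp_substitution[of f, symmetric]) (auto intro!: nn_integral_cong simp: fg indicator_def)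
  moreover have "(\<integral>\<^sup>+s. \<psi> s * indicator {0<..} s \<partial>lborel) = (\<integral>\<^sup>+x. ennreal (G x) \<partial>lborel)"
    unfolding G_def
    by (subst nn_integral_half_line_exp_substitution[of g, symmetric]) (auto intro!: nn_integral_cong simp: fg indicator_def)
  ultimately show ?thesis using * by simp
qed

section \<open>Products of Lebesgue measure and half-spaces\<close>

text \<open>
  Euclidean space is modelled by functions on a finite index set, so that a dimension can be added by
  inserting an index and one can argue by induction over the index set.
\<close>

abbreviation Leb :: "'i set \<Rightarrow> ('i \<Rightarrow> real) measure" where
  "Leb I \<equiv> Pi\<^sub>M I (\<lambda>_. lborel)"

interpretation lborel_product: product_sigma_finite "\<lambda>_. lborel :: real measure"
  by standard

lemma measurable_fun_upd_dim:
  "(\<lambda>(x, y). x(k := y)) \<in> measurable (Leb I \<Otimes>\<^sub>M lborel) (Leb (insert k I))"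
  by (rule measurable_add_dim)

lemma measurable_fun_upd_Leb:
  assumes [measurable]: "h \<in> borel_measurable (Leb (insert k I))"
  shows "(\<lambda>x. h (x(k := y))) \<in> borel_measurable (Leb I)"
    and "x \<in> space (Leb I) \<Longrightarrow> (\<lambda>y. h (x(k := y))) \<in> borel_measurable lborel"
    and "(\<lambda>(x, y). h (x(k := y))) \<in> borel_measurable (Leb I \<Otimes>\<^sub>M lborel)"
proof -
  have *: "(\<lambda>(x, y). x(k := y)) \<in> measurable (Leb I \<Otimes>\<^sub>M lborel) (Leb (insert k I))"
    by (rule measurable_add_dim)
  show "(\<lambda>(x, y). h (x(k := y))) \<in> borel_measurable (Leb I \<Otimes>\<^sub>M lborel)"
    using measurable_compose[OF * assms] by (simp add: case_prod_beta')
  have "(\<lambda>x. (x, y)) \<in> measurable (Leb I) (Leb I \<Otimes>\<^sub>M lborel)" by measurable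
  from measurable_compose[OF measurable_compose[OF this *] assms]
  show "(\<lambda>x. h (x(k := y))) \<in> borel_measurable (Leb I)" by simp
  assume x: "x \<in> space (Leb I)"
  have "(\<lambda>y. (x, y)) \<in> measurable lborel (Leb I \<Otimes>\<^sub>M lborel)" using x by measurable
  from measurable_compose[OF measurable_compose[OF this *] assms]
  show "(\<lambda>y. h (x(k := y))) \<in> borel_measurable lborel" by simp
qed

lemma nn_integral_Leb_translate:
  fixes t :: "'i \<Rightarrow> real"
  assumes I: "finite I" and h[measurable]: "h \<in> borel_measurable (Leb I)"
  shows "(\<integral>\<^sup>+x. h (\<lambda>i\<in>I. x i + t i) \<partial>Leb I) = (\<integral>\<^sup>+x. h x \<partial>Leb I)"
proof -
  have [measurable]: "(\<lambda>x. \<lambda>i\<in>I. x i + t i) \<in> measurable (Leb I) (Leb I)"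
    by measurable
  have "distr (Leb I) (Leb I) (\<lambda>x. \<lambda>i\<in>I. x i + t i) = Leb I"
  proof (rule lborel_product.PiM_eqI)
    fix A :: "'i \<Rightarrow> real set" assume "\<And>i. i \<in> I \<Longrightarrow> A i \<in> sets lborel"
    then have A: "\<And>i. i \<in> I \<Longrightarrow> A i \<in> sets borel" by simp
    have "(\<lambda>x. \<lambda>i\<in>I. x i + t i) -` Pi\<^sub>E I A \<inter> space (Leb I) = Pi\<^sub>E I (\<lambda>i. {x. t i + 1 * x \<in> A i})"
      by (auto simp: space_PiM PiE_iff add.commute)
    then have "emeasure (distr (Leb I) (Leb I) (\<lambda>x. \<lambda>i\<in>I. x i + t i)) (Pi\<^sub>E I A) 
        = emeasure (Leb I) (Pi\<^sub>E I (\<lambda>i. {x. t i + 1 * x \<in> A i}))"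
      using A I by (subst emeasure_distr) (auto intro!: sets_PiM_I_finite)
    also have "\<dots> = (\<Prod>i\<in>I. emeasure lborel {x. t i + 1 * x \<in> A i})"
      using A I by (intro lborel_product.emeasure_PiM) auto
    also have "\<dots> = (\<Prod>i\<in>I. emeasure lborel (A i))"
      using A emeasure_lborel_affine_vimage[where c=1] by (intro prod.cong) auto
    finally show "emeasure (distr (Leb I) (Leb I) (\<lambda>x. \<lambda>i\<in>I. x i + t i)) (Pi\<^sub>E I A) = (\<Prod>i\<in>I. emeasure lborel (A i))" .
  qed (use I in simp_all)
  then have "(\<integral>\<^sup>+x. h x \<partial>Leb I) = (\<integral>\<^sup>+x. h x \<partial>distr (Leb I) (Leb I) (\<lambda>x. \<lambda>i\<in>I. x i + t i))" by simp
  also have "\<dots> = (\<integral>\<^sup>+x. h (\<lambda>i\<in>I. x i + t i) \<partial>Leb I)"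
    by (subst nn_integral_distr) auto
  finally show ?thesis by simp
qed

text \<open>
  Adding a combination of the coordinates in \<open>I\<close> to the \<open>k\<close>-th coordinate, and adding multiples of
  the \<open>k\<close>-th coordinate to those in \<open>I\<close>. The signs make each of the two maps the inverse transpose of the
  other, so that they change the variables of a function and of its polar simultaneously.
\<close>

definition vshear :: "'i set \<Rightarrow> 'i \<Rightarrow> ('i \<Rightarrow> real) \<Rightarrow> ('i \<Rightarrow> real) \<Rightarrow> 'i \<Rightarrow> real" where
  "vshear I k a x = x(k := x k - (\<Sum>i\<in>I. a i * x i))"

definition hshear :: "'i set \<Rightarrow> 'i \<Rightarrow> ('i \<Rightarrow> real) \<Rightarrow> ('i \<Rightarrow> real) \<Rightarrow> 'i \<Rightarrow> real" where
  "hshear I k a x = (\<lambda>i\<in>insert k I. if i = k then x k else x i + a i * x k)"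

lemma shear_dual:
  assumes "finite I" "k \<notin> I"
  shows "(\<Sum>i\<in>insert k I. vshear I k a x i * hshear I k a y i) = (\<Sum>i\<in>insert k I. x i * y i)"
proof -
  have "(\<Sum>i\<in>I. vshear I k a x i * hshear I k a y i) = (\<Sum>i\<in>I. x i * y i) + (\<Sum>i\<in>I. a i * x i) * y k"
  proof -
    have "(\<Sum>i\<in>I. vshear I k a x i * hshear I k a y i) = (\<Sum>i\<in>I. x i * (y i + a i * y k))"
      using assms by (intro sum.cong) (auto simp: vshear_def hshear_def)
    then show ?thesis by (simp add: sum_distrib_left sum.distrib algebra_simps)
  qed
  then show ?thesis
    using assms by (simp add: algebra_simps) (simp add: vshear_def hshear_def algebra_simps)
qed

lemma measurable_vshear[measurable]: 
  "k \<notin> I \<Longrightarrow> vshear I k a \<in> measurable (Leb (insert k I)) (Leb (insert k I))"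
proof -
  have "(\<lambda>x. (x, x k - (\<Sum>i\<in>I. a i * x i))) \<in> measurable (Leb (insert k I)) (Leb (insert k I) \<Otimes>\<^sub>M lborel)"
    by measurable
  from measurable_compose[OF this measurable_fun_upd_dim[of k]] show ?thesis
    by (simp add: vshear_def[abs_def])
qed

lemma measurable_hshear[measurable]: "hshear I k a \<in> measurable (Leb (insert k I)) (Leb (insert k I))"
  unfolding hshear_def[abs_def] by measurable

text \<open>
  On each line parallel to the \<open>k\<close>-th axis the shear is a translation.
\<close>

lemma nn_integral_vshear:
  assumes I: "finite I" "k \<notin> I" and h[measurable]: "h \<in> borel_measurable (Leb (insert k I))"
  shows "(\<integral>\<^sup>+x. h (vshear I k a x) \<partial>Leb (insert k I)) = (\<integral>\<^sup>+x. h x \<partial>Leb (insert k I))"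
proof -
  have "(\<integral>\<^sup>+x. h (vshear I k a x) \<partial>Leb (insert k I)) = (\<integral>\<^sup>+x. \<integral>\<^sup>+y. h (vshear I k a (x(k := y))) \<partial>lborel \<partial>Leb I)"
    using I by (intro lborel_product.product_nn_integral_insert) measurable
  also have "\<dots> = (\<integral>\<^sup>+x. \<integral>\<^sup>+y. h (x(k := y)) \<partial>lborel \<partial>Leb I)"
  proof (rule nn_integral_cong)
    fix x assume x: "x \<in> space (Leb I)"
    have "vshear I k a (x(k := y)) = x(k := - (\<Sum>i\<in>I. a i * x i) + 1 * y)" for y
    proof -
      have "(\<Sum>i\<in>I. a i * (x(k := y)) i) = (\<Sum>i\<in>I. a i * x i)" using I by (intro sum.cong) auto
      then show ?thesis by (simp add: vshear_def)
    qed
    then show "(\<integral>\<^sup>+y. h (vshear I k a (x(k := y))) \<partial>lborel) = (\<integral>\<^sup>+y. h (x(k := y)) \<partial>lborel)"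
      using nn_integral_real_affine[of "\<lambda>y. h (x(k := y))" 1 "- (\<Sum>i\<in>I. a i * x i)"] measurable_fun_upd_Leb(2)[OF h x]
      by simp
  qed
  also have "\<dots> = (\<integral>\<^sup>+x. h x \<partial>Leb (insert k I))"
    using I by (intro lborel_product.product_nn_integral_insert[symmetric]) measurable
  finally show ?thesis .
qed

text \<open>
  On each hyperplane on which the \<open>k\<close>-th coordinate is constant the shear is a translation.
\<close>

lemma nn_integral_hshear:
  assumes I: "finite I" "k \<notin> I" and h[measurable]: "h \<in> borel_measurable (Leb (insert k I))"
  shows "(\<integral>\<^sup>+x. h (hshear I k a x) \<partial>Leb (insert k I)) = (\<integral>\<^sup>+x. h x \<partial>Leb (insert k I))"
proof -
  have "(\<integral>\<^sup>+x. h (hshear I k a x) \<partial>Leb (insert k I)) = (\<integral>\<^sup>+y. \<integral>\<^sup>+x. h (hshear I k a (x(k := y))) \<partial>Leb I \<partial>lborel)"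
    using I by (intro lborel_product.product_nn_integral_insert_rev) measurable
  also have "\<dots> = (\<integral>\<^sup>+y. \<integral>\<^sup>+x. h ((\<lambda>i\<in>I. x i + a i * y)(k := y)) \<partial>Leb I \<partial>lborel)"
    using I by (intro nn_integral_cong arg_cong[where f=h]) (auto simp: hshear_def fun_eq_iff)
  also have "\<dots> = (\<integral>\<^sup>+y. \<integral>\<^sup>+x. h (x(k := y)) \<partial>Leb I \<partial>lborel)"
    using I by (intro nn_integral_cong nn_integral_Leb_translate[where h="\<lambda>x. h (x(k := _))"] measurable_fun_upd_Leb h)
  also have "\<dots> = (\<integral>\<^sup>+x. h x \<partial>Leb (insert k I))"
    using I by (intro lborel_product.product_nn_integral_insert_rev[symmetric]) measurable
  finally show ?thesis .
qed

text \<open>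
  The integral of \<open>h\<close> with weight \<open>f\<close> exists and vanishes. Stated through the positive and the negative
  part of \<open>h\<close>, it makes sense for weights with infinite values, such as integrals over
  fibres, and is compatible with Tonelli's theorem.
\<close>

definition zero_mean :: "'a measure \<Rightarrow> ('a \<Rightarrow> ennreal) \<Rightarrow> ('a \<Rightarrow> real) \<Rightarrow> bool" where
  "zero_mean M f h \<longleftrightarrow>
     (\<integral>\<^sup>+x. f x * ennreal (h x) \<partial>M) = (\<integral>\<^sup>+x. f x * ennreal (- h x) \<partial>M) \<and>
     (\<integral>\<^sup>+x. f x * ennreal (h x) \<partial>M) < \<infinity>"

lemma zero_mean_iff_density:
  assumes [measurable]: "f \<in> borel_measurable M" "h \<in> borel_measurable M"
  shows "zero_mean M f h \<longleftrightarrow> integrable (density M f) h \<and> integral\<^sup>L (density M f) h = 0"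
proof -
  have *: "(\<integral>\<^sup>+x. f x * ennreal (c * h x) \<partial>M) = (\<integral>\<^sup>+x. ennreal (c * h x) \<partial>density M f)" for c
    by (subst nn_integral_density) auto
  show ?thesis
    unfolding zero_mean_def using *[of 1] *[of "-1"]
    by (auto simp: real_integrable_def real_lebesgue_integral_def less_top) (metis ennreal_enn2real less_top)
qed

text \<open>
  The functional Santalo inequality for weights with barycenter at the origin. It is stated for all dual
  pairs \<open>f\<close>, \<open>g\<close> and not only for the polar of \<open>f\<close>: such pairs are inherited by fibre integrals and by
  truncations.
\<close>

definition centered_santalo :: "'i set \<Rightarrow> bool" where
  "centered_santalo I \<longleftrightarrow> (\<forall>f g. f \<in> borel_measurable (Leb I) \<longrightarrow> g \<in> borel_measurable (Leb I) \<longrightarrow>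
     (\<forall>i\<in>I. zero_mean (Leb I) f (\<lambda>x. x i)) \<longrightarrow>
     (\<forall>x\<in>space (Leb I). \<forall>y\<in>space (Leb I). f x * g y \<le> ennreal (exp (- (\<Sum>i\<in>I. x i * y i)))) \<longrightarrow>
     (\<integral>\<^sup>+x. f x \<partial>Leb I) * (\<integral>\<^sup>+y. g y \<partial>Leb I) \<le> ennreal ((2 * pi) ^ card I))"

lemma nn_integral_Leb_half_space:
  fixes \<sigma> :: real
  assumes I: "finite I" "k \<notin> I" and \<sigma>: "\<bar>\<sigma>\<bar> = 1"
    and f[measurable]: "f \<in> borel_measurable (Leb (insert k I))"
    and u[measurable]: "u \<in> borel_measurable (Leb I)"
  shows "(\<integral>\<^sup>+x. f x * indicator {0<..} (\<sigma> * x k) * u (restrict x I) \<partial>Leb (insert k I))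
    = (\<integral>\<^sup>+x. (\<integral>\<^sup>+s. f (x(k := \<sigma> * s)) * indicator {0<..} s \<partial>lborel) * u x \<partial>Leb I)"
proof -
  have [measurable]: "(\<lambda>x. restrict x I) \<in> measurable (Leb (insert k I)) (Leb I)"
    by (rule measurable_restrict_subset) auto
  have "(\<integral>\<^sup>+x. f x * indicator {0<..} (\<sigma> * x k) * u (restrict x I) \<partial>Leb (insert k I))
     = (\<integral>\<^sup>+x. \<integral>\<^sup>+y. f (x(k := y)) * indicator {0<..} (\<sigma> * (x(k := y)) k) * u (restrict (x(k := y)) I) \<partial>lborel \<partial>Leb I)"
    using I by (intro lborel_product.product_nn_integral_insert) measurable
  also have "\<dots> = (\<integral>\<^sup>+x. (\<integral>\<^sup>+s. f (x(k := \<sigma> * s)) * indicator {0<..} s \<partial>lborel) * u x \<partial>Leb I)"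
  proof (rule nn_integral_cong)
    fix x assume x: "x \<in> space (Leb I)"
    note measurable_fun_upd_Leb(2)[OF f x, measurable]
    have r: "restrict (x(k := y)) I = x" for y
      using x I by (auto simp: space_PiM PiE_iff fun_eq_iff extensional_def)
    have "(\<integral>\<^sup>+y. f (x(k := y)) * indicator {0<..} (\<sigma> * y) \<partial>lborel)
      = ennreal \<bar>\<sigma>\<bar> * (\<integral>\<^sup>+s. f (x(k := 0 + \<sigma> * s)) * indicator {0<..} (\<sigma> * (0 + \<sigma> * s)) \<partial>lborel)"
      using \<sigma> by (intro nn_integral_real_affine) auto
    moreover have "\<sigma> * (\<sigma> * s) = s" for s using \<sigma> by (auto simp: abs_if split: if_splits)
    ultimately show "(\<integral>\<^sup>+y. f (x(k := y)) * indicator {0<..} (\<sigma> * (x(k := y)) k) * u (restrict (x(k := y)) I) \<partial>lborel)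
      = (\<integral>\<^sup>+s. f (x(k := \<sigma> * s)) * indicator {0<..} s \<partial>lborel) * u x"
      using \<sigma> by (simp add: r nn_integral_multc)
  qed
  finally show ?thesis .
qed

text \<open>
  Integrate \<open>f\<close> and \<open>g\<close> over the half-lines parallel to the \<open>k\<close>-th axis. For any two such half-lines the
  one-dimensional inequality applies, with a constant that is exactly the dual kernel in the remaining
  coordinates. Up to the factor \<open>pi / 2\<close> the fibre integrals are therefore a dual pair in one dimension less,
  and the inequality for centered weights applies to it.
\<close>

lemma half_space_santalo:
  fixes \<sigma> :: real
  assumes I: "finite I" "k \<notin> I" and \<sigma>: "\<bar>\<sigma>\<bar> = 1"
    and santalo: "centered_santalo I"
    and f[measurable]: "f \<in> borel_measurable (Leb (insert k I))"
    and g[measurable]: "g \<in> borel_measurable (Leb (insert k I))"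
    and centered: "\<And>i. i \<in> I \<Longrightarrow> zero_mean (Leb (insert k I)) (\<lambda>x. f x * indicator {0<..} (\<sigma> * x k)) (\<lambda>x. x i)"
    and dual: "\<And>x y. x \<in> space (Leb (insert k I)) \<Longrightarrow> y \<in> space (Leb (insert k I)) \<Longrightarrow>
      f x * g y \<le> ennreal (exp (- (\<Sum>i\<in>insert k I. x i * y i)))"
  shows "(\<integral>\<^sup>+x. f x * indicator {0<..} (\<sigma> * x k) \<partial>Leb (insert k I)) *
    (\<integral>\<^sup>+y. g y * indicator {0<..} (\<sigma> * y k) \<partial>Leb (insert k I)) \<le> ennreal ((2 * pi) ^ card (insert k I) / 4)"
proof -
  define F G where "F x = (\<integral>\<^sup>+s. f (x(k := \<sigma> * s)) * indicator {0<..} s \<partial>lborel)"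
    and "G x = (\<integral>\<^sup>+s. g (x(k := \<sigma> * s)) * indicator {0<..} s \<partial>lborel)" for x
  have upd: "(\<lambda>(x, s). x(k := \<sigma> * s)) \<in> measurable (Leb I \<Otimes>\<^sub>M lborel) (Leb (insert k I))"
  proof -
    have "(\<lambda>(x, s). (x, \<sigma> * s)) \<in> measurable (Leb I \<Otimes>\<^sub>M lborel) (Leb I \<Otimes>\<^sub>M lborel)" by measurable
    from measurable_compose[OF this measurable_fun_upd_dim[of k]] show ?thesis by (simp add: case_prod_beta')
  qed
  have [measurable]: "F \<in> borel_measurable (Leb I)" "G \<in> borel_measurable (Leb I)"
  proof -
    have *: "(\<lambda>(x, s). h (x(k := \<sigma> * s)) * indicator {0<..} s) \<in> borel_measurable (Leb I \<Otimes>\<^sub>M lborel)" 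
      if "h \<in> borel_measurable (Leb (insert k I))" for h :: "('a \<Rightarrow> real) \<Rightarrow> ennreal"
    proof -
      have [measurable]: "(\<lambda>p. h ((fst p)(k := \<sigma> * snd p))) \<in> borel_measurable (Leb I \<Otimes>\<^sub>M lborel)"
        using measurable_compose[OF upd that] by (simp add: case_prod_beta')
      show ?thesis unfolding case_prod_beta' by measurable
    qed
    show "F \<in> borel_measurable (Leb I)" "G \<in> borel_measurable (Leb I)"
      unfolding F_def G_def using *[OF f] *[OF g] by (auto intro!: lborel.borel_measurable_nn_integral)
  qed
  have FG: "F x * G y \<le> ennreal (exp (- (\<Sum>i\<in>I. x i * y i)) * (pi / 2))"
    if x: "x \<in> space (Leb I)" and y: "y \<in> space (Leb I)" for x y
    unfolding F_def G_def
  proof (rule half_line_santalo)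
    note measurable_fun_upd_Leb(2)[OF f x, measurable] measurable_fun_upd_Leb(2)[OF g y, measurable]
    show "(\<lambda>s. f (x(k := \<sigma> * s))) \<in> borel_measurable borel" "(\<lambda>s. g (y(k := \<sigma> * s))) \<in> borel_measurable borel"
      by measurable
    fix s t :: real
    have sp: "x(k := \<sigma> * s) \<in> space (Leb (insert k I))" "y(k := \<sigma> * t) \<in> space (Leb (insert k I))"
      using x y by (auto simp: space_PiM PiE_iff extensional_def)
    have "(\<Sum>i\<in>I. (x(k := \<sigma> * s)) i * (y(k := \<sigma> * t)) i) = (\<Sum>i\<in>I. x i * y i)"
      using I by (intro sum.cong) auto
    moreover have "\<sigma> * s * (\<sigma> * t) = s * t" using \<sigma> by (auto simp: abs_if split: if_splits)
    ultimately have "(\<Sum>i\<in>insert k I. (x(k := \<sigma> * s)) i * (y(k := \<sigma> * t)) i) = (\<Sum>i\<in>I. x i * y i) + s * t"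
      by (simp only: sum.insert[OF I] fun_upd_same add.commute)
    then show "f (x(k := \<sigma> * s)) * g (y(k := \<sigma> * t)) \<le> ennreal (exp (- (\<Sum>i\<in>I. x i * y i)) * exp (- (s * t)))"
      using dual[OF sp] by (simp only: exp_add[symmetric] minus_add_distrib)
  qed simp
  have f_eq: "(\<integral>\<^sup>+x. f x * indicator {0<..} (\<sigma> * x k) \<partial>Leb (insert k I)) = (\<integral>\<^sup>+x. F x \<partial>Leb I)"
    unfolding F_def using nn_integral_Leb_half_space[OF I \<sigma> f, of "\<lambda>_. 1"] by simp
  have g_eq: "(\<integral>\<^sup>+x. g x * indicator {0<..} (\<sigma> * x k) \<partial>Leb (insert k I)) = (\<integral>\<^sup>+x. G x \<partial>Leb I)"
    unfolding G_def using nn_integral_Leb_half_space[OF I \<sigma> g, of "\<lambda>_. 1"] by simp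
  have "zero_mean (Leb I) F (\<lambda>x. x i)" if i: "i \<in> I" for i
  proof -
    have [measurable]: "(\<lambda>x. ennreal (c * x i)) \<in> borel_measurable (Leb I)" for c using i by measurable
    have "(\<integral>\<^sup>+x. F x * ennreal (c * x i) \<partial>Leb I)
      = (\<integral>\<^sup>+x. f x * indicator {0<..} (\<sigma> * x k) * ennreal (c * x i) \<partial>Leb (insert k I))" for c
      unfolding F_def using nn_integral_Leb_half_space[OF I \<sigma> f, of "\<lambda>x. ennreal (c * x i)"] i by simp
    from this[of 1] this[of "-1"] show ?thesis
      using centered[OF i] unfolding zero_mean_def by auto
  qed
  moreover have "F x * (G y * ennreal (2 / pi)) \<le> ennreal (exp (- (\<Sum>i\<in>I. x i * y i)))"
    if "x \<in> space (Leb I)" "y \<in> space (Leb I)" for x y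
  proof -
    have "F x * G y * ennreal (2 / pi) \<le> ennreal (exp (- (\<Sum>i\<in>I. x i * y i)) * (pi / 2)) * ennreal (2 / pi)"
      using FG[OF that] by (rule mult_right_mono) simp
    also have "\<dots> = ennreal (exp (- (\<Sum>i\<in>I. x i * y i)))"
      by (simp add: ennreal_mult[symmetric])
    finally show ?thesis by (simp add: mult.assoc)
  qed
  ultimately have "(\<integral>\<^sup>+x. F x \<partial>Leb I) * (\<integral>\<^sup>+y. G y * ennreal (2 / pi) \<partial>Leb I) \<le> ennreal ((2 * pi) ^ card I)"
    using santalo[unfolded centered_santalo_def, rule_format, of F "\<lambda>y. G y * ennreal (2 / pi)"] by auto
  then have "(\<integral>\<^sup>+x. F x \<partial>Leb I) * ((\<integral>\<^sup>+y. G y \<partial>Leb I) * ennreal (2 / pi)) * ennreal (pi / 2) \<le> ennreal ((2 * pi) ^ card I) * ennreal (pi / 2)"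
    by (intro mult_right_mono) (simp_all add: nn_integral_multc)
  moreover have "(\<integral>\<^sup>+x. F x \<partial>Leb I) * ((\<integral>\<^sup>+y. G y \<partial>Leb I) * ennreal (2 / pi)) * ennreal (pi / 2) 
    = (\<integral>\<^sup>+x. F x \<partial>Leb I) * (\<integral>\<^sup>+y. G y \<partial>Leb I) * (ennreal (2 / pi) * ennreal (pi / 2))"
    by (simp only: ac_simps)
  moreover have "ennreal (2 / pi) * ennreal (pi / 2) = 1" by (simp add: ennreal_mult[symmetric])
  moreover have "ennreal ((2 * pi) ^ card I) * ennreal (pi / 2) = ennreal ((2 * pi) ^ card (insert k I) / 4)"
    using I by (simp add: ennreal_mult[symmetric])
  ultimately show ?thesis unfolding f_eq g_eq by simp
qed

section \<open>Coordinate hyperplanes and the induction on the dimension\<close>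

lemma borel_measurable_Leb_component: "i \<in> I \<Longrightarrow> (\<lambda>x. x i) \<in> borel_measurable (Leb I)"
  using measurable_component_singleton[of i I "\<lambda>_. lborel"] by simp

lemma AE_Leb_component_neq:
  assumes "finite I" "k \<in> I"
  shows "AE x in Leb I. x k \<noteq> c"
proof (rule AE_I)
  let ?A = "\<lambda>i. if i = k then {c} else UNIV :: real set"
  show "{x \<in> space (Leb I). \<not> x k \<noteq> c} \<subseteq> Pi\<^sub>E I ?A"
    by (auto simp: space_PiM PiE_iff extensional_def)
  have "emeasure (Leb I) (Pi\<^sub>E I ?A) = (\<Prod>i\<in>I. emeasure lborel (?A i))"
    using assms by (intro lborel_product.emeasure_PiM) auto
  also have "\<dots> = 0" using assms by (intro prod_zero) (auto intro!: bexI[of _ k])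
  finally show "emeasure (Leb I) (Pi\<^sub>E I ?A) = 0" .
  show "Pi\<^sub>E I ?A \<in> sets (Leb I)" using assms by (intro sets_PiM_I_finite) auto
qed

lemma nn_integral_Leb_split:
  assumes I: "finite I" "k \<in> I" and [measurable]: "h \<in> borel_measurable (Leb I)"
  shows "(\<integral>\<^sup>+x. h x \<partial>Leb I) = (\<integral>\<^sup>+x. h x * indicator {0<..} (x k - c) \<partial>Leb I) + (\<integral>\<^sup>+x. h x * indicator {0<..} (c - x k) \<partial>Leb I)"
proof -
  have [measurable]: "(\<lambda>x. x k) \<in> borel_measurable (Leb I)" using I by measurable
  have "(\<integral>\<^sup>+x. h x \<partial>Leb I) = (\<integral>\<^sup>+x. h x * indicator {0<..} (x k - c) + h x * indicator {0<..} (c - x k) \<partial>Leb I)"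
  proof (rule nn_integral_cong_AE)
    show "AE x in Leb I. h x = h x * indicator {0<..} (x k - c) + h x * indicator {0<..} (c - x k)"
      using AE_Leb_component_neq[OF I, of c] by eventually_elim (auto simp: indicator_def)
  qed
  then show ?thesis by (simp add: nn_integral_add)
qed

lemma nn_integral_hshear_translate:
  assumes I: "finite I" "k \<notin> I" and h[measurable]: "h \<in> borel_measurable (Leb (insert k I))"
  shows "(\<integral>\<^sup>+x. h (\<lambda>i\<in>insert k I. hshear I k a x i + z i) \<partial>Leb (insert k I)) = (\<integral>\<^sup>+x. h x \<partial>Leb (insert k I))"
proof -
  have m: "(\<lambda>x. h (\<lambda>i\<in>insert k I. x i + z i)) \<in> borel_measurable (Leb (insert k I))" by measurable
  show ?thesis
    using nn_integral_hshear[OF I m, of a] nn_integral_Leb_translate[OF _ h, of z] I by simp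
qed

lemma ennreal_mult_le_imp_le_divide:
  assumes "ennreal A * X \<le> ennreal K" "0 < A" "0 \<le> K"
  shows "X \<le> ennreal (K / A)"
proof -
  have "X = ennreal (1 / A) * (ennreal A * X)"
    using assms by (simp add: mult.assoc[symmetric] ennreal_mult[symmetric])
  also have "\<dots> \<le> ennreal (1 / A) * ennreal K" using assms by (intro mult_left_mono) auto
  also have "\<dots> = ennreal (K / A)" using assms by (simp add: ennreal_mult[symmetric])
  finally show ?thesis .
qed

text \<open>
  The parameters \<open>z\<close> and \<open>w\<close> describe the line through the barycenters of the two parts into which the
  hyperplane \<open>x k = c\<close> cuts \<open>f\<close>: it meets the hyperplane in \<open>z\<close>, and \<open>w\<close> gives its slopes. After
  projection along this line both parts are centered at \<open>z\<close>. For each coordinate these are two linear equations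
  in two unknowns. They can be solved because the barycenters lie strictly on opposite sides.
\<close>

lemma balancing_line:
  fixes f :: "('i \<Rightarrow> real) \<Rightarrow> ennreal" and A :: "real \<Rightarrow> real"
  assumes I: "finite I" "k \<notin> I"
    and f[measurable]: "f \<in> borel_measurable (Leb (insert k I))"
    and moments: "\<And>i. i \<in> insert k I \<Longrightarrow> (\<integral>\<^sup>+x. f x * ennreal \<bar>x i\<bar> \<partial>Leb (insert k I)) < \<infinity>"
    and mass: "\<And>\<sigma>. \<sigma> \<in> {-1, 1} \<Longrightarrow> (\<integral>\<^sup>+x. f x * indicator {0<..} (\<sigma> * (x k - c)) \<partial>Leb (insert k I)) = ennreal (A \<sigma>)"
    and pos: "\<And>\<sigma>. \<sigma> \<in> {-1, 1} \<Longrightarrow> 0 < A \<sigma>"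
  obtains z w where "z k = c"
    "\<And>i \<sigma>. i \<in> I \<Longrightarrow> \<sigma> \<in> {-1, 1} \<Longrightarrow> zero_mean (Leb (insert k I)) 
       (\<lambda>x. f x * indicator {0<..} (\<sigma> * (x k - c))) (\<lambda>x. x i - z i - w i * (x k - c))"
proof -
  let ?M = "Leb (insert k I)"
  define F where "F \<sigma> x = f x * indicator {0<..} (\<sigma> * (x k - c))" for \<sigma> x
  define \<mu> where "\<mu> \<sigma> = density ?M (F \<sigma>)" for \<sigma>
  have [measurable]: "F \<sigma> \<in> borel_measurable ?M" for \<sigma> unfolding F_def by measurable
  have comp[measurable]: "(\<lambda>x. x i) \<in> borel_measurable ?M" if "i \<in> insert k I" for i using that by measurable
  have int: "integrable (\<mu> \<sigma>) (\<lambda>x. x i)" if i: "i \<in> insert k I" for i \<sigma>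
  proof (rule integrableI_bounded)
    show "(\<lambda>x. x i) \<in> borel_measurable (\<mu> \<sigma>)" using comp[OF i] by (simp add: \<mu>_def)
    note comp[OF i, measurable]
    have "(\<integral>\<^sup>+x. ennreal (norm (x i)) \<partial>\<mu> \<sigma>) = (\<integral>\<^sup>+x. F \<sigma> x * ennreal \<bar>x i\<bar> \<partial>?M)"
      unfolding \<mu>_def by (subst nn_integral_density) auto
    also have "\<dots> \<le> (\<integral>\<^sup>+x. f x * ennreal \<bar>x i\<bar> \<partial>?M)"
      by (intro nn_integral_mono mult_right_mono) (auto simp: F_def indicator_def)
    also have "\<dots> < \<infinity>" by (rule moments[OF i])
    finally show "(\<integral>\<^sup>+x. ennreal (norm (x i)) \<partial>\<mu> \<sigma>) < \<infinity>" .
  qed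
  have space: "emeasure (\<mu> \<sigma>) (space (\<mu> \<sigma>)) = ennreal (A \<sigma>)" if "\<sigma> \<in> {-1, 1}" for \<sigma>
    using mass[OF that] by (simp add: \<mu>_def F_def emeasure_density cong: nn_integral_cong)
  have const: "integrable (\<mu> \<sigma>) (\<lambda>_. b::real)" "(\<integral>x. b \<partial>\<mu> \<sigma>) = A \<sigma> * b" if s: "\<sigma> \<in> {-1, 1}" for \<sigma> b
  proof -
    interpret finite_measure "\<mu> \<sigma>" using space[OF s] by (intro finite_measureI) auto
    show "integrable (\<mu> \<sigma>) (\<lambda>_. b)" by simp
    show "(\<integral>x. b \<partial>\<mu> \<sigma>) = A \<sigma> * b" using space[OF s] pos[OF s] by (simp add: measure_def)
  qed
  define m where "m \<sigma> i = (\<integral>x. x i \<partial>\<mu> \<sigma>)" for \<sigma> i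
  define d where "d \<sigma> = (\<integral>x. x k - c \<partial>\<mu> \<sigma>)" for \<sigma>
  have d: "0 < \<sigma> * d \<sigma>" if s: "\<sigma> \<in> {-1, 1}" for \<sigma>
  proof -
    interpret finite_measure "\<mu> \<sigma>" using space[OF s] by (intro finite_measureI) auto
    have "(\<integral>x. 0 \<partial>\<mu> \<sigma>) < (\<integral>x. \<sigma> * (x k - c) \<partial>\<mu> \<sigma>)"
    proof (rule integral_less_AE_space)
      show "AE x in \<mu> \<sigma>. 0 < \<sigma> * (x k - c)" unfolding \<mu>_def
        by (subst AE_density) (auto simp: F_def indicator_def split: if_splits)
      show "emeasure (\<mu> \<sigma>) (space (\<mu> \<sigma>)) \<noteq> 0" using space[OF s] pos[OF s] by simp
    qed (use int const[OF s] in auto)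
    then show ?thesis by (simp add: d_def)
  qed
  define D where "D = A 1 * d (-1) - A (-1) * d 1"
  have "0 < A (-1) * d 1" "0 < A 1 * (- d (-1))"
    using d[of 1] d[of "-1"] pos[of 1] pos[of "-1"] by (intro mult_pos_pos; simp)+
  then have D: "D \<noteq> 0" by (simp add: D_def)
  \<comment> \<open>Cramer's rule for the two balancing equations; D is their determinant.\<close>
  define z w where "z i = (if i = k then c else (m 1 i * d (-1) - m (-1) i * d 1) / D)"
    and "w i = (A 1 * m (-1) i - A (-1) * m 1 i) / D" for i
  have solve: "m \<sigma> i - A \<sigma> * z i - w i * d \<sigma> = 0" if "\<sigma> \<in> {-1, 1}" "i \<in> I" for \<sigma> i
  proof -
    have "i \<noteq> k" using that I by auto
    then have zw: "z i * D = m 1 i * d (-1) - m (-1) i * d 1" "w i * D = A 1 * m (-1) i - A (-1) * m 1 i"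
      using D by (simp_all add: z_def w_def)
    have "(m \<sigma> i - A \<sigma> * z i - w i * d \<sigma>) * D = m \<sigma> i * D - A \<sigma> * (z i * D) - (w i * D) * d \<sigma>"
      by (simp add: algebra_simps)
    also have "\<dots> = 0"
      unfolding zw using that(1) by (auto simp: D_def algebra_simps)
    finally have "(m \<sigma> i - A \<sigma> * z i - w i * d \<sigma>) * D = 0" .
    then show ?thesis using D by simp
  qed
  show ?thesis
  proof (rule that)
    show "z k = c" by (simp add: z_def)
    fix i \<sigma> assume i: "i \<in> I" and s: "\<sigma> \<in> {-1, 1::real}"
    note int' = int[of i \<sigma>] int[of k \<sigma>] const[OF s]
    have "(\<integral>x. x i - z i - w i * (x k - c) \<partial>\<mu> \<sigma>) = m \<sigma> i - A \<sigma> * z i - w i * d \<sigma>"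
      unfolding m_def d_def using int' i by simp
    moreover have "integrable (\<mu> \<sigma>) (\<lambda>x. x i - z i - w i * (x k - c))"
      using int' i by auto
    moreover note comp[of i, measurable]
    ultimately have "zero_mean ?M (F \<sigma>) (\<lambda>x. x i - z i - w i * (x k - c))"
      using solve[OF s i] i by (subst zero_mean_iff_density) (auto simp: \<mu>_def)
    then show "zero_mean ?M (\<lambda>x. f x * indicator {0<..} (\<sigma> * (x k - c))) (\<lambda>x. x i - z i - w i * (x k - c))"
      by (simp add: F_def[abs_def])
  qed
qed

text \<open>
  A horizontal shear makes the line through the two barycenters vertical, and a translation moves its point \<open>z\<close> on
  the hyperplane to the origin. The function \<open>g\<close> has to be transformed by the dual shear. Now
  the half-space inequality applies on both sides of the hyperplane, and adding the two bounds for \<open>g\<close>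
  gives the claim. The point \<open>z\<close> depends on \<open>f\<close> alone and serves for all \<open>g\<close>.
\<close>

lemma coordinate_hyperplane_santalo:
  fixes f :: "('i \<Rightarrow> real) \<Rightarrow> ennreal" and A B c :: real
  assumes I: "finite I" "k \<notin> I"
    and santalo: "centered_santalo I"
    and f[measurable]: "f \<in> borel_measurable (Leb (insert k I))"
    and moments: "\<And>i. i \<in> insert k I \<Longrightarrow> (\<integral>\<^sup>+x. f x * ennreal \<bar>x i\<bar> \<partial>Leb (insert k I)) < \<infinity>"
    and A: "(\<integral>\<^sup>+x. f x * indicator {0<..} (x k - c) \<partial>Leb (insert k I)) = ennreal A" "0 < A"
    and B: "(\<integral>\<^sup>+x. f x * indicator {0<..} (c - x k) \<partial>Leb (insert k I)) = ennreal B" "0 < B"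
  shows "\<exists>z. z k = c \<and> (\<forall>g\<in>borel_measurable (Leb (insert k I)).
      (\<forall>x\<in>space (Leb (insert k I)). \<forall>y\<in>space (Leb (insert k I)).
        f x * g y \<le> ennreal (exp (- (\<Sum>i\<in>insert k I. (x i - z i) * y i)))) \<longrightarrow>
      (\<integral>\<^sup>+y. g y \<partial>Leb (insert k I)) \<le> ennreal ((2 * pi) ^ card (insert k I) / 4 * (1 / A + 1 / B)))"
proof -
  let ?M = "Leb (insert k I)"
  let ?A = "\<lambda>\<sigma>. if \<sigma> = 1 then A else B"
  obtain z w where z: "z k = c"
    and bal: "\<And>i \<sigma>. i \<in> I \<Longrightarrow> \<sigma> \<in> {-1, 1} \<Longrightarrow> zero_mean ?M 
       (\<lambda>x. f x * indicator {0<..} (\<sigma> * (x k - c))) (\<lambda>x. x i - z i - w i * (x k - c))"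
    by (rule balancing_line[OF I f moments, where A="?A"]) (use A B in auto)
  define S where "S x = (\<lambda>i\<in>insert k I. hshear I k w x i + z i)" for x
  have [measurable]: "(\<lambda>x. x k) \<in> borel_measurable ?M" by measurable
  have "(\<lambda>x. \<lambda>i\<in>insert k I. x i + z i) \<in> measurable ?M ?M" by measurable
  then have [measurable]: "S \<in> measurable ?M ?M"
    unfolding S_def[abs_def] by (rule measurable_compose[OF measurable_hshear])
  have S: "(\<integral>\<^sup>+x. h (S x) \<partial>?M) = (\<integral>\<^sup>+x. h x \<partial>?M)" if "h \<in> borel_measurable ?M" for h
    unfolding S_def using that by (intro nn_integral_hshear_translate I)
  have Sk: "S x k = x k + c" for x by (simp add: S_def hshear_def z)
  have Si: "S x i - z i - w i * (S x k - c) = x i" if "i \<in> I" for x i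
    using that I unfolding Sk by (auto simp: S_def hshear_def)
  show ?thesis
  proof (intro exI[of _ z] conjI z ballI impI)
    fix g assume g[measurable]: "g \<in> borel_measurable ?M"
      and dual: "\<forall>x\<in>space ?M. \<forall>y\<in>space ?M.
        f x * g y \<le> ennreal (exp (- (\<Sum>i\<in>insert k I. (x i - z i) * y i)))"
    define g' where "g' y = g (vshear I k w y)" for y
    have [measurable]: "vshear I k w \<in> measurable ?M ?M" using I by measurable
    have [measurable]: "g' \<in> borel_measurable ?M" unfolding g'_def by measurable
    have half: "ennreal (?A \<sigma>) * (\<integral>\<^sup>+y. g' y * indicator {0<..} (\<sigma> * y k) \<partial>?M) \<le> ennreal ((2 * pi) ^ card (insert k I) / 4)"
      if s: "\<sigma> \<in> {-1, 1}" for \<sigma>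
    proof -
      have "(\<integral>\<^sup>+x. f (S x) * indicator {0<..} (\<sigma> * x k) \<partial>?M) * (\<integral>\<^sup>+y. g' y * indicator {0<..} (\<sigma> * y k) \<partial>?M)
        \<le> ennreal ((2 * pi) ^ card (insert k I) / 4)"
      proof (rule half_space_santalo[OF I _ santalo])
        show "\<bar>\<sigma>\<bar> = 1" using s by auto
        show "(\<lambda>x. f (S x)) \<in> borel_measurable ?M" by measurable
        fix i assume i: "i \<in> I"
        then have "i \<in> insert k I" by simp
        then have [measurable]: "(\<lambda>x. x i) \<in> borel_measurable ?M" by (rule borel_measurable_Leb_component)
        have "(\<integral>\<^sup>+x. f (S x) * indicator {0<..} (\<sigma> * x k) * ennreal (b * x i) \<partial>?M)
          = (\<integral>\<^sup>+x. f x * indicator {0<..} (\<sigma> * (x k - c)) * ennreal (b * (x i - z i - w i * (x k - c))) \<partial>?M)" for b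
        proof -
          have "(\<integral>\<^sup>+x. f (S x) * indicator {0<..} (\<sigma> * x k) * ennreal (b * x i) \<partial>?M)
            = (\<integral>\<^sup>+x. f (S x) * indicator {0<..} (\<sigma> * (S x k - c)) * ennreal (b * (S x i - z i - w i * (S x k - c))) \<partial>?M)"
            by (simp only: Si[OF i]) (simp add: Sk)
          also have "\<dots> = (\<integral>\<^sup>+x. f x * indicator {0<..} (\<sigma> * (x k - c)) * ennreal (b * (x i - z i - w i * (x k - c))) \<partial>?M)"
            by (rule S[of "\<lambda>x. f x * indicator {0<..} (\<sigma> * (x k - c)) * ennreal (b * (x i - z i - w i * (x k - c)))"]) measurable
          finally show ?thesis .
        qed
        from this[of 1] this[of "-1"]
        show "zero_mean ?M (\<lambda>x. f (S x) * indicator {0<..} (\<sigma> * x k)) (\<lambda>x. x i)"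
          using bal[OF i s] unfolding zero_mean_def by auto
      next
        fix x y assume x: "x \<in> space ?M" and y: "y \<in> space ?M"
        have sp: "S x \<in> space ?M" "vshear I k w y \<in> space ?M"
          using x y by (auto intro: measurable_space[of _ ?M ?M])
        have "(\<Sum>i\<in>insert k I. (S x i - z i) * vshear I k w y i) = (\<Sum>i\<in>insert k I. vshear I k w y i * hshear I k w x i)"
          by (intro sum.cong) (auto simp: S_def)
        also have "\<dots> = (\<Sum>i\<in>insert k I. x i * y i)"
          unfolding shear_dual[OF I] by (simp add: mult.commute)
        finally show "f (S x) * g' y \<le> ennreal (exp (- (\<Sum>i\<in>insert k I. x i * y i)))"
          using dual[rule_format, OF sp] by (simp add: g'_def)
      qed (measurable)
      moreover have "(\<integral>\<^sup>+x. f (S x) * indicator {0<..} (\<sigma> * x k) \<partial>?M) = (\<integral>\<^sup>+x. f x * indicator {0<..} (\<sigma> * (x k - c)) \<partial>?M)"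
        using S[of "\<lambda>x. f x * indicator {0<..} (\<sigma> * (x k - c))"] by (simp add: Sk)
      moreover have "\<dots> = ennreal (?A \<sigma>)" using s A B by auto
      ultimately show ?thesis by simp
    qed
    define K where "K = (2 * pi) ^ card (insert k I) / 4"
    have "0 \<le> K" by (simp add: K_def)
    note half = half[folded K_def]
    have "(\<integral>\<^sup>+y. g y \<partial>?M) = (\<integral>\<^sup>+y. g' y \<partial>?M)"
      unfolding g'_def using nn_integral_vshear[OF I g] by simp
    also have "\<dots> = (\<integral>\<^sup>+y. g' y * indicator {0<..} (1 * y k) \<partial>?M) + (\<integral>\<^sup>+y. g' y * indicator {0<..} ((-1) * y k) \<partial>?M)"
      using I by (subst nn_integral_Leb_split[where k=k and c=0]) auto
    also have "\<dots> \<le> ennreal (K / A) + ennreal (K / B)"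
      using half[of 1] half[of "-1"] A B \<open>0 \<le> K\<close> by (intro add_mono ennreal_mult_le_imp_le_divide) auto
    also have "\<dots> = ennreal (K * (1 / A + 1 / B))"
      using A B \<open>0 \<le> K\<close> by (subst ennreal_plus[symmetric]) (auto simp: field_simps)
    finally show "(\<integral>\<^sup>+y. g y \<partial>?M) \<le> ennreal ((2 * pi) ^ card (insert k I) / 4 * (1 / A + 1 / B))"
      unfolding K_def .
  qed
qed


lemma zero_mean_linear:
  assumes I: "finite I" and [measurable]: "f \<in> borel_measurable (Leb I)"
    and mean: "\<And>i. i \<in> I \<Longrightarrow> zero_mean (Leb I) f (\<lambda>x. x i)"
  shows "zero_mean (Leb I) f (\<lambda>x. \<Sum>i\<in>I. z i * x i)"
proof -
  have "integrable (density (Leb I) f) (\<lambda>x. x i) \<and> (\<integral>x. x i \<partial>density (Leb I) f) = 0" if "i \<in> I" for i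
    using mean[OF that] that by (subst (asm) zero_mean_iff_density) measurable
  then show ?thesis
    by (subst zero_mean_iff_density) auto
qed

text \<open>
  This is \<open>exp t \<ge> 1 + t\<close>: the linear term integrates to zero.
\<close>

lemma nn_integral_exp_tilt_ge:
  assumes [measurable]: "f \<in> borel_measurable M" "h \<in> borel_measurable M"
    and mean: "zero_mean M f h"
  shows "(\<integral>\<^sup>+x. f x \<partial>M) \<le> (\<integral>\<^sup>+x. f x * ennreal (exp (h x)) \<partial>M)"
proof -
  let ?p = "\<integral>\<^sup>+x. f x * ennreal (h x) \<partial>M"
  have "1 + ennreal (h x) \<le> ennreal (exp (h x)) + ennreal (- h x)" for x
  proof -
    have "1 + ennreal (h x) = ennreal (1 + max 0 (h x))"
      by (simp add: max_def ennreal_neg)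
    also have "\<dots> \<le> ennreal (exp (h x) + max 0 (- h x))"
      using exp_ge_add_one_self[of "h x"] by (intro ennreal_leI) linarith
    also have "\<dots> = ennreal (exp (h x)) + ennreal (- h x)"
      by (simp add: max_def ennreal_neg flip: ennreal_plus)
    finally show ?thesis .
  qed
  then have "(\<integral>\<^sup>+x. f x * (1 + ennreal (h x)) \<partial>M) \<le> (\<integral>\<^sup>+x. f x * (ennreal (exp (h x)) + ennreal (- h x)) \<partial>M)"
    by (intro nn_integral_mono mult_left_mono) auto
  then have "?p + (\<integral>\<^sup>+x. f x \<partial>M) \<le> ?p + (\<integral>\<^sup>+x. f x * ennreal (exp (h x)) \<partial>M)"
    using mean by (simp add: distrib_left nn_integral_add zero_mean_def add.commute)
  then show ?thesis
    using mean by (subst (asm) ennreal_add_left_cancel_le) (auto simp: zero_mean_def)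
qed

text \<open>
  The distribution of the \<open>k\<close>-th coordinate has no atoms, so its distribution function is continuous and takes
  the value \<open>m / 2\<close>.
\<close>

lemma median_coordinate:
  assumes I: "finite I" "k \<in> I" and f[measurable]: "f \<in> borel_measurable (Leb I)"
    and m: "(\<integral>\<^sup>+x. f x \<partial>Leb I) = ennreal m" "0 < m"
  obtains c where "(\<integral>\<^sup>+x. f x * indicator {0<..} (x k - c) \<partial>Leb I) = ennreal (m / 2)"
    "(\<integral>\<^sup>+x. f x * indicator {0<..} (c - x k) \<partial>Leb I) = ennreal (m / 2)"
proof -
  have k[measurable]: "(\<lambda>x. x k) \<in> borel_measurable (Leb I)" using I by measurable
  define \<nu> where "\<nu> = distr (density (Leb I) f) borel (\<lambda>x. x k)"
  have em: "emeasure \<nu> S = (\<integral>\<^sup>+x. f x * indicator S (x k) \<partial>Leb I)" if [measurable]: "S \<in> sets borel" for S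
  proof -
    have "emeasure \<nu> S = emeasure (density (Leb I) f) ((\<lambda>x. x k) -` S \<inter> space (Leb I))"
      unfolding \<nu>_def using that by (subst emeasure_distr) auto
    also have "\<dots> = (\<integral>\<^sup>+x. f x * indicator ((\<lambda>x. x k) -` S \<inter> space (Leb I)) x \<partial>Leb I)"
      by (subst emeasure_density) auto
    also have "\<dots> = (\<integral>\<^sup>+x. f x * indicator S (x k) \<partial>Leb I)"
      by (intro nn_integral_cong) (auto simp: indicator_def)
    finally show ?thesis .
  qed
  have tot: "emeasure \<nu> (space \<nu>) = ennreal m" using em[of UNIV] m by (simp add: \<nu>_def)
  interpret finite_borel_measure \<nu>
    by (intro finite_borel_measure.intro finite_borel_measure_axioms.intro finite_measureI) (simp_all add: tot, simp add: \<nu>_def)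
  have "measure \<nu> {c} = 0" for c
  proof -
    have "emeasure \<nu> {c} = (\<integral>\<^sup>+x. 0 \<partial>Leb I)"
      unfolding em[of "{c}", simplified]
      using AE_Leb_component_neq[OF I, of c] by (intro nn_integral_cong_AE) (auto elim!: eventually_mono simp: indicator_def)
    then show ?thesis by (simp add: measure_def)
  qed
  then have cont: "continuous_on UNIV (cdf \<nu>)"
    by (auto simp: continuous_on_eq_continuous_at isCont_cdf)
  have mm: "measure \<nu> (space \<nu>) = m" using tot m by (simp add: measure_def)
  have "\<forall>\<^sub>F c in at_top. m / 2 < cdf \<nu> c" "\<forall>\<^sub>F c in at_bot. cdf \<nu> c < m / 2"
    using order_tendstoD(1)[OF cdf_lim_at_top, of "m / 2"] order_tendstoD(2)[OF cdf_lim_at_bot, of "m / 2"] m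
    unfolding mm by simp_all
  then obtain a b where ab: "\<And>c. a \<le> c \<Longrightarrow> m / 2 < cdf \<nu> c" "\<And>c. c \<le> b \<Longrightarrow> cdf \<nu> c < m / 2"
    by (auto simp: eventually_at_top_linorder eventually_at_bot_linorder)
  have "\<exists>c\<ge>min a b. c \<le> max a b \<and> cdf \<nu> c = m / 2"
  proof (rule IVT')
    show "cdf \<nu> (min a b) \<le> m / 2" using ab(2)[of "min a b"] by simp
    show "m / 2 \<le> cdf \<nu> (max a b)" using ab(1)[of "max a b"] by simp
    show "continuous_on {min a b..max a b} (cdf \<nu>)" using cont by (rule continuous_on_subset) auto
  qed simp
  then obtain c where c: "cdf \<nu> c = m / 2" by auto
  have "(\<integral>\<^sup>+x. f x * indicator {0<..} (c - x k) \<partial>Leb I) = (\<integral>\<^sup>+x. f x * indicator {..c} (x k) \<partial>Leb I)"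
    using AE_Leb_component_neq[OF I, of c] by (intro nn_integral_cong_AE) (auto elim!: eventually_mono simp: indicator_def)
  also have "\<dots> = emeasure \<nu> {..c}" by (simp add: em)
  also have "\<dots> = ennreal (m / 2)" by (simp only: emeasure_eq_measure c[unfolded cdf_def])
  finally have 1: "(\<integral>\<^sup>+x. f x * indicator {0<..} (c - x k) \<partial>Leb I) = ennreal (m / 2)" .
  have "ennreal m = (\<integral>\<^sup>+x. f x * indicator {0<..} (x k - c) \<partial>Leb I) + ennreal (m / 2)"
    using nn_integral_Leb_split[OF I f, of c] m 1 by simp
  then have "(\<integral>\<^sup>+x. f x * indicator {0<..} (x k - c) \<partial>Leb I) = ennreal m - ennreal (m / 2)" by simp
  also have "\<dots> = ennreal (m / 2)" using m by (subst ennreal_minus) (auto simp: field_simps)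
  finally show ?thesis using 1 that by blast
qed

text \<open>
  The roles of \<open>f\<close> and \<open>g\<close> are exchanged. Cut \<open>g\<close> into halves by a hyperplane \<open>x k = c\<close>. The
  hyperplane inequality yields a point \<open>z\<close>, and \<open>f\<close> multiplied by \<open>exp \<phi>\<close>, where \<open>\<phi>\<close> is the
  scalar product with \<open>z\<close>, is dual to \<open>g\<close> with respect to \<open>z\<close>. As \<open>f\<close> is centered, this factor
  does not decrease the integral. The bound on \<open>g\<close> and on its support guarantees that its mass and its first
  moments are finite.
\<close>

lemma santalo_bounded_support:
  fixes f g :: "('i \<Rightarrow> real) \<Rightarrow> ennreal" and R :: nat
  assumes I: "finite I" "k \<notin> I" and santalo: "centered_santalo I"
    and f[measurable]: "f \<in> borel_measurable (Leb (insert k I))"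
    and g[measurable]: "g \<in> borel_measurable (Leb (insert k I))"
    and mean: "\<And>i. i \<in> insert k I \<Longrightarrow> zero_mean (Leb (insert k I)) f (\<lambda>x. x i)"
    and dual: "\<And>x y. x \<in> space (Leb (insert k I)) \<Longrightarrow> y \<in> space (Leb (insert k I)) \<Longrightarrow>
      f x * g y \<le> ennreal (exp (- (\<Sum>i\<in>insert k I. x i * y i)))"
    and bounded: "\<And>y. g y \<le> of_nat R" 
    and support: "\<And>y i. i \<in> insert k I \<Longrightarrow> real R < \<bar>y i\<bar> \<Longrightarrow> g y = 0"
  shows "(\<integral>\<^sup>+x. f x \<partial>Leb (insert k I)) * (\<integral>\<^sup>+y. g y \<partial>Leb (insert k I)) \<le> ennreal ((2 * pi) ^ card (insert k I))"
proof (cases "(\<integral>\<^sup>+y. g y \<partial>Leb (insert k I)) = 0")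
  case False
  let ?M = "Leb (insert k I)"
  let ?B = "Pi\<^sub>E (insert k I) (\<lambda>_. {- real R..real R})"
  have B: "?B \<in> sets ?M" using I by (intro sets_PiM_I_finite) auto
  have "g y \<le> of_nat R * indicator ?B y" if y: "y \<in> space ?M" for y
  proof (cases "y \<in> ?B")
    case False
    then obtain i where "i \<in> insert k I" "y i \<notin> {- real R..real R}"
      using y unfolding space_PiM PiE_iff by auto
    then have "i \<in> insert k I" "real R < \<bar>y i\<bar>" by auto
    then show ?thesis using support by simp
  qed (use bounded in auto)
  then have "(\<integral>\<^sup>+y. g y \<partial>?M) \<le> (\<integral>\<^sup>+y. of_nat R * indicator ?B y \<partial>?M)"
    by (rule nn_integral_mono)
  also have "\<dots> = of_nat R * (\<Prod>i\<in>insert k I. emeasure lborel {- real R..real R})"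
    using I B by (subst nn_integral_cmult) (auto simp: lborel_product.emeasure_PiM)
  also have "\<dots> < \<infinity>" by (simp add: ennreal_mult_less_top power_less_top_ennreal of_nat_less_top flip: ennreal_of_nat_eq_real_of_nat)
  finally have fin: "(\<integral>\<^sup>+y. g y \<partial>?M) < \<infinity>" .
  then obtain m where m: "(\<integral>\<^sup>+y. g y \<partial>?M) = ennreal m" "0 \<le> m"
    by (cases "\<integral>\<^sup>+y. g y \<partial>?M") auto
  with False have "0 < m" by (cases "m = 0") auto
  obtain c where c: "(\<integral>\<^sup>+x. g x * indicator {0<..} (x k - c) \<partial>?M) = ennreal (m / 2)"
    "(\<integral>\<^sup>+x. g x * indicator {0<..} (c - x k) \<partial>?M) = ennreal (m / 2)"
    by (rule median_coordinate[OF _ _ g m(1) \<open>0 < m\<close>, of k]) (use I in auto)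
  have moments: "(\<integral>\<^sup>+y. g y * ennreal \<bar>y i\<bar> \<partial>?M) < \<infinity>" if i: "i \<in> insert k I" for i
  proof -
    have "(\<integral>\<^sup>+y. g y * ennreal \<bar>y i\<bar> \<partial>?M) \<le> (\<integral>\<^sup>+y. g y * ennreal (real R) \<partial>?M)"
    proof (rule nn_integral_mono)
      fix y show "g y * ennreal \<bar>y i\<bar> \<le> g y * ennreal (real R)"
        using support[OF i, of y] by (cases "real R < \<bar>y i\<bar>") (auto intro!: mult_left_mono)
    qed
    also have "\<dots> < \<infinity>" using fin by (simp add: nn_integral_multc ennreal_mult_less_top)
    finally show ?thesis .
  qed
  have "\<exists>z. z k = c \<and> (\<forall>h\<in>borel_measurable ?M.
      (\<forall>x\<in>space ?M. \<forall>y\<in>space ?M. g x * h y \<le> ennreal (exp (- (\<Sum>i\<in>insert k I. (x i - z i) * y i)))) \<longrightarrow>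
      (\<integral>\<^sup>+y. h y \<partial>?M) \<le> ennreal ((2 * pi) ^ card (insert k I) / 4 * (1 / (m / 2) + 1 / (m / 2))))"
    using \<open>0 < m\<close> by (intro coordinate_hyperplane_santalo I santalo g moments c) simp_all
  then obtain z where z: "\<forall>h\<in>borel_measurable ?M.
      (\<forall>x\<in>space ?M. \<forall>y\<in>space ?M. g x * h y \<le> ennreal (exp (- (\<Sum>i\<in>insert k I. (x i - z i) * y i)))) \<longrightarrow>
      (\<integral>\<^sup>+y. h y \<partial>?M) \<le> ennreal ((2 * pi) ^ card (insert k I) / 4 * (1 / (m / 2) + 1 / (m / 2)))"
    by blast
  \<comment> \<open>The exponential of this linear form shifts the centre of duality from the origin to z.\<close>
  define \<phi> where "\<phi> x = (\<Sum>i\<in>insert k I. z i * x i)" for x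
  have [measurable]: "\<phi> \<in> borel_measurable ?M" unfolding \<phi>_def by measurable
  have "zero_mean ?M f \<phi>" unfolding \<phi>_def using I mean by (intro zero_mean_linear) auto
  then have "(\<integral>\<^sup>+x. f x \<partial>?M) \<le> (\<integral>\<^sup>+x. f x * ennreal (exp (\<phi> x)) \<partial>?M)"
    by (intro nn_integral_exp_tilt_ge) auto
  also have "\<dots> \<le> ennreal ((2 * pi) ^ card (insert k I) / 4 * (1 / (m / 2) + 1 / (m / 2)))"
  proof (intro z[rule_format])
    fix x y assume x: "x \<in> space ?M" and y: "y \<in> space ?M"
    have "g x * (f y * ennreal (exp (\<phi> y))) = f y * g x * ennreal (exp (\<phi> y))" by (simp only: ac_simps)
    also have "\<dots> \<le> ennreal (exp (- (\<Sum>i\<in>insert k I. y i * x i))) * ennreal (exp (\<phi> y))"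
      by (intro mult_right_mono dual x y) simp
    also have "\<dots> = ennreal (exp (- (\<Sum>i\<in>insert k I. y i * x i) + \<phi> y))"
      by (subst ennreal_mult[symmetric]) (simp_all only: exp_add exp_ge_zero)
    also have "- (\<Sum>i\<in>insert k I. y i * x i) + \<phi> y = - (\<Sum>i\<in>insert k I. (x i - z i) * y i)"
      by (simp only: \<phi>_def sum_negf[symmetric] sum.distrib[symmetric]) (simp add: algebra_simps)
    finally show "g x * (f y * ennreal (exp (\<phi> y))) \<le> ennreal (exp (- (\<Sum>i\<in>insert k I. (x i - z i) * y i)))" .
  qed measurable
  finally have "(\<integral>\<^sup>+x. f x \<partial>?M) \<le> ennreal ((2 * pi) ^ card (insert k I) / m)"
    using \<open>0 < m\<close> by (simp add: field_simps)
  then have "(\<integral>\<^sup>+x. f x \<partial>?M) * ennreal m \<le> ennreal ((2 * pi) ^ card (insert k I) / m) * ennreal m"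
    by (rule mult_right_mono) simp
  then show ?thesis
    using \<open>0 < m\<close> unfolding m(1) by (simp add: ennreal_mult[symmetric])
qed simp

text \<open>
  Any truncation of \<open>g\<close> still forms a dual pair with \<open>f\<close>, so the inequality passes to the limit by monotone
  convergence.
\<close>

lemma centered_santalo_insert:
  assumes I: "finite I" "k \<notin> I" and santalo: "centered_santalo I"
  shows "centered_santalo (insert k I)"
  unfolding centered_santalo_def
proof (intro allI impI)
  fix f g :: "('a \<Rightarrow> real) \<Rightarrow> ennreal"
  let ?M = "Leb (insert k I)"
  assume f[measurable]: "f \<in> borel_measurable ?M" and g[measurable]: "g \<in> borel_measurable ?M"
    and mean: "\<forall>i\<in>insert k I. zero_mean ?M f (\<lambda>x. x i)"
    and dual: "\<forall>x\<in>space ?M. \<forall>y\<in>space ?M. f x * g y \<le> ennreal (exp (- (\<Sum>i\<in>insert k I. x i * y i)))"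
  show "(\<integral>\<^sup>+x. f x \<partial>?M) * (\<integral>\<^sup>+y. g y \<partial>?M) \<le> ennreal ((2 * pi) ^ card (insert k I))"
  proof (cases "\<exists>x\<in>space ?M. f x \<noteq> 0")
    case False
    then have "(\<integral>\<^sup>+x. f x \<partial>?M) = (\<integral>\<^sup>+x. 0 \<partial>?M)" by (intro nn_integral_cong) auto
    then show ?thesis by simp
  next
    case True
    then obtain x0 where x0: "x0 \<in> space ?M" "f x0 \<noteq> 0" by auto
    \<comment> \<open>Since g is finite, the truncations are eventually equal to it at each point.\<close>
    have g_fin: "g y < \<infinity>" if "y \<in> space ?M" for y
    proof -
      have "f x0 * g y < \<infinity>" using dual[rule_format, OF x0(1) that] by (rule le_less_trans) simp
      then show ?thesis using x0 by (auto simp: ennreal_mult_less_top)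
    qed
    \<comment> \<open>Cutting off both the values and the support makes the mass and the first moments finite.\<close>
    define T where "T R y = (if \<forall>i\<in>insert k I. \<bar>y i\<bar> \<le> real R then min (g y) (of_nat R) else 0)" for R :: nat and y
    have [measurable]: "T R \<in> borel_measurable ?M" for R
    proof -
      have "Measurable.pred ?M (\<lambda>y. \<forall>i\<in>insert k I. \<bar>y i\<bar> \<le> real R)"
      proof (intro pred_intros_finite)
        fix i assume "i \<in> insert k I"
        then have [measurable]: "(\<lambda>y. y i) \<in> borel_measurable ?M" by (rule borel_measurable_Leb_component)
        show "Measurable.pred ?M (\<lambda>y. \<bar>y i\<bar> \<le> real R)" by measurable
      qed (use I in simp)
      then show ?thesis unfolding T_def[abs_def] by measurable
    qed
    have Tg: "T R y \<le> g y" for R y by (simp add: T_def)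
    have bound: "(\<integral>\<^sup>+x. f x \<partial>?M) * (\<integral>\<^sup>+y. T R y \<partial>?M) \<le> ennreal ((2 * pi) ^ card (insert k I))" for R
    proof (rule santalo_bounded_support[OF I santalo f, where R=R])
      fix x y assume "x \<in> space ?M" "y \<in> space ?M"
      then show "f x * T R y \<le> ennreal (exp (- (\<Sum>i\<in>insert k I. x i * y i)))"
        using dual by (meson Tg mult_left_mono order_trans zero_le)
    next
      show "T R \<in> borel_measurable ?M" by measurable
    qed (use mean in \<open>auto simp: T_def\<close>)
    have inc: "incseq T"
    proof (intro incseq_SucI le_funI)
      fix R y
      have "(of_nat R :: ennreal) \<le> of_nat (Suc R)" by simp
      then show "T R y \<le> T (Suc R) y" unfolding T_def
        by (auto intro: min.coboundedI2 min.mono) 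
    qed
    have lim: "(\<lambda>R. T R y) \<longlonglongrightarrow> g y" if y: "y \<in> space ?M" for y
    proof -
      obtain r where r: "g y = ennreal r" using g_fin[OF y] by (cases "g y") auto
      obtain N :: nat where N: "max r (\<Sum>i\<in>insert k I. \<bar>y i\<bar>) \<le> real N" using real_arch_simple by blast
      have "T R y = g y" if "N \<le> R" for R
      proof -
        have "\<bar>y i\<bar> \<le> real R" if "i \<in> insert k I" for i
          using member_le_sum[OF that, of "\<lambda>i. \<bar>y i\<bar>"] I N \<open>N \<le> R\<close> by auto
        moreover have "g y \<le> of_nat R"
          using N \<open>N \<le> R\<close> unfolding r by (simp add: ennreal_of_nat_eq_real_of_nat ennreal_leI)
        ultimately show ?thesis by (simp add: T_def min_absorb1)
      qed
      then show ?thesis by (intro tendsto_eventually) (auto simp: eventually_sequentially)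
    qed
    have "(\<integral>\<^sup>+y. g y \<partial>?M) = (\<integral>\<^sup>+y. (SUP R. T R y) \<partial>?M)"
    proof (rule nn_integral_cong)
      fix y assume y: "y \<in> space ?M"
      have "(\<lambda>R. T R y) \<longlonglongrightarrow> (SUP R. T R y)"
        using inc by (intro LIMSEQ_SUP) (auto simp: incseq_def le_fun_def)
      with lim[OF y] show "g y = (SUP R. T R y)" by (rule LIMSEQ_unique)
    qed
    also have "\<dots> = (SUP R. \<integral>\<^sup>+y. T R y \<partial>?M)"
      using inc by (intro nn_integral_monotone_convergence_SUP) auto
    finally have "(\<integral>\<^sup>+y. g y \<partial>?M) = (SUP R. \<integral>\<^sup>+y. T R y \<partial>?M)" .
    then have "(\<integral>\<^sup>+x. f x \<partial>?M) * (\<integral>\<^sup>+y. g y \<partial>?M) = (SUP R. (\<integral>\<^sup>+x. f x \<partial>?M) * (\<integral>\<^sup>+y. T R y \<partial>?M))"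
      by (simp add: SUP_mult_left_ennreal)
    also have "\<dots> \<le> ennreal ((2 * pi) ^ card (insert k I))" using bound by (intro SUP_least)
    finally show ?thesis .
  qed
qed

lemma centered_santalo:
  assumes "finite I" shows "centered_santalo I"
  using assms
proof (induction I)
  case empty
  show ?case unfolding centered_santalo_def
    by (auto simp: lborel_product.nn_integral_empty space_PiM)
next
  case (insert k I)
  then show ?case by (intro centered_santalo_insert)
qed

section \<open>Arbitrary hyperplanes\<close>

text \<open>
  Choose a coordinate \<open>k\<close> on which the hyperplane is a graph over the other coordinates. A vertical shear
  turns it into a hyperplane on which the \<open>k\<close>-th coordinate is constant; the dual shear acts on \<open>g\<close>.
\<close>

lemma hyperplane_santalo:
  fixes f :: "'a::euclidean_space \<Rightarrow> ennreal" and a :: 'a and b P Q :: real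
  assumes f[measurable]: "f \<in> borel_measurable borel"
    and moment: "(\<integral>\<^sup>+x. f x * ennreal (norm x) \<partial>lborel) < \<infinity>"
    and a: "a \<noteq> 0"
    and P: "(\<integral>\<^sup>+x. f x * indicator {x. b < a \<bullet> x} x \<partial>lborel) = ennreal P" "0 < P"
    and Q: "(\<integral>\<^sup>+x. f x * indicator {x. a \<bullet> x < b} x \<partial>lborel) = ennreal Q" "0 < Q"
  shows "\<exists>z. a \<bullet> z = b \<and> (\<forall>g\<in>borel_measurable borel. (\<forall>x y. f x * g y \<le> ennreal (exp (- ((x - z) \<bullet> y)))) \<longrightarrow>
      (\<integral>\<^sup>+y. g y \<partial>lborel) \<le> ennreal ((2 * pi) ^ DIM('a) / 4 * (1 / P + 1 / Q)))"
proof -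
  obtain k where k: "k \<in> Basis" "a \<bullet> k \<noteq> 0" using a by (auto simp: euclidean_eq_iff[of a])
  define I :: "'a set" where "I = Basis - {k}"
  have I: "finite I" "k \<notin> I" and K: "insert k I = Basis" using k by (auto simp: I_def)
  let ?M = "Leb (Basis :: 'a set)"
  define \<alpha> where "\<alpha> i = (a \<bullet> i) / (a \<bullet> k)" for i
  define c where "c = b / (a \<bullet> k)"
  define \<Phi> :: "('a \<Rightarrow> real) \<Rightarrow> 'a" where "\<Phi> x = (\<Sum>i\<in>Basis. x i *\<^sub>R i)" for x
  define V H where "V = vshear I k \<alpha>" and "H = hshear I k \<alpha>"
  have comp[measurable]: "(\<lambda>x. x i) \<in> borel_measurable ?M" if "i \<in> Basis" for i
    using that by (rule borel_measurable_Leb_component)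
  have \<Phi>m[measurable]: "\<Phi> \<in> borel_measurable ?M" unfolding \<Phi>_def[abs_def] by measurable
  have [measurable]: "V \<in> measurable ?M ?M" "H \<in> measurable ?M ?M"
    unfolding V_def H_def using measurable_vshear[OF I(2), of \<alpha>] measurable_hshear[of I k \<alpha>] K by simp_all
  have \<Phi>: "(\<integral>\<^sup>+x. h (\<Phi> x) \<partial>?M) = (\<integral>\<^sup>+x. h x \<partial>lborel)" if [measurable]: "h \<in> borel_measurable borel" for h
    by (subst lborel_eq) (simp add: nn_integral_distr \<Phi>_def[symmetric])
  have V: "(\<integral>\<^sup>+x. h (\<Phi> (V x)) \<partial>?M) = (\<integral>\<^sup>+x. h x \<partial>lborel)" if [measurable]: "h \<in> borel_measurable borel" for h
    using nn_integral_vshear[OF I, of "\<lambda>x. h (\<Phi> x)" \<alpha>] \<Phi>[OF that] unfolding K V_def by simp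
  have H: "(\<integral>\<^sup>+x. h (\<Phi> (H x)) \<partial>?M) = (\<integral>\<^sup>+x. h x \<partial>lborel)" if [measurable]: "h \<in> borel_measurable borel" for h
    using nn_integral_hshear[OF I, of "\<lambda>x. h (\<Phi> x)" \<alpha>] \<Phi>[OF that] unfolding K H_def by simp
  have \<Phi>_inner: "\<Phi> x \<bullet> \<Phi> y = (\<Sum>i\<in>Basis. x i * y i)" for x y
    unfolding \<Phi>_def by (simp add: inner_sum_left inner_sum_right inner_Basis if_distrib sum.If_cases mult.commute cong: if_cong)
  have \<Phi>_coord: "\<Phi> x \<bullet> i = x i" if "i \<in> Basis" for x i
    using that unfolding \<Phi>_def by simp
  have aV: "a \<bullet> \<Phi> (V u) = (a \<bullet> k) * u k" for u
  proof -
    have "a \<bullet> \<Phi> (V u) = (\<Sum>i\<in>insert k I. V u i * (a \<bullet> i))"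
      unfolding K \<Phi>_def by (simp add: inner_sum_right)
    also have "\<dots> = V u k * (a \<bullet> k) + (\<Sum>i\<in>I. V u i * (a \<bullet> i))" using I by simp
    also have "(\<Sum>i\<in>I. V u i * (a \<bullet> i)) = (\<Sum>i\<in>I. u i * (a \<bullet> i))"
      using I by (intro sum.cong) (auto simp: V_def vshear_def)
    also have "V u k * (a \<bullet> k) = u k * (a \<bullet> k) - (\<Sum>i\<in>I. u i * (a \<bullet> i))"
    proof -
      have "(\<Sum>i\<in>I. \<alpha> i * u i) * (a \<bullet> k) = (\<Sum>i\<in>I. u i * (a \<bullet> i))"
        unfolding sum_distrib_right using k(2) by (intro sum.cong) (auto simp: \<alpha>_def)
      then show ?thesis by (simp add: V_def vshear_def left_diff_distrib)
    qed
    finally show ?thesis by (simp add: mult.commute)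
  qed
  have VH: "(\<Phi> (V u) - \<Phi> (V u')) \<bullet> \<Phi> (H v) = (\<Sum>i\<in>Basis. (u i - u' i) * v i)" for u u' v
  proof -
    have "\<Phi> (V x) \<bullet> \<Phi> (H v) = (\<Sum>i\<in>Basis. x i * v i)" for x
      unfolding \<Phi>_inner V_def H_def using shear_dual[OF I, of \<alpha> x v] unfolding K .
    then show ?thesis by (simp add: inner_diff_left left_diff_distrib sum_subtractf)
  qed
  define F where "F u = f (\<Phi> (V u))" for u
  have F[measurable]: "F \<in> borel_measurable ?M" unfolding F_def by measurable
  have moments: "(\<integral>\<^sup>+u. F u * ennreal \<bar>u i\<bar> \<partial>?M) < \<infinity>" if i: "i \<in> Basis" for i
  proof -
    have "\<exists>e. \<forall>u. u i = e \<bullet> \<Phi> (V u)"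
    proof (cases "i = k")
      case True
      then have "u i = (a /\<^sub>R (a \<bullet> k)) \<bullet> \<Phi> (V u)" for u using k(2) by (simp add: aV)
      then show ?thesis by blast
    next
      case False
      then have "u i = i \<bullet> \<Phi> (V u)" for u using i by (subst inner_commute) (simp add: \<Phi>_coord V_def vshear_def)
      then show ?thesis by blast
    qed
    then obtain e where e: "\<And>u. u i = e \<bullet> \<Phi> (V u)" by blast
    have "(\<integral>\<^sup>+u. F u * ennreal \<bar>u i\<bar> \<partial>?M) = (\<integral>\<^sup>+u. f (\<Phi> (V u)) * ennreal \<bar>e \<bullet> \<Phi> (V u)\<bar> \<partial>?M)"
      unfolding F_def using e by (intro nn_integral_cong) presburger
    also have "\<dots> = (\<integral>\<^sup>+x. f x * ennreal \<bar>e \<bullet> x\<bar> \<partial>lborel)"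
      by (rule V[of "\<lambda>x. f x * ennreal \<bar>e \<bullet> x\<bar>"]) measurable
    also have "\<dots> \<le> (\<integral>\<^sup>+x. ennreal (norm e) * (f x * ennreal (norm x)) \<partial>lborel)"
    proof (rule nn_integral_mono)
      fix x :: 'a
      have "f x * ennreal \<bar>e \<bullet> x\<bar> \<le> f x * ennreal (norm e * norm x)"
        by (intro mult_left_mono ennreal_leI Cauchy_Schwarz_ineq2) simp
      then show "f x * ennreal \<bar>e \<bullet> x\<bar> \<le> ennreal (norm e) * (f x * ennreal (norm x))"
        by (simp add: ennreal_mult ac_simps)
    qed
    also have "\<dots> < \<infinity>" using moment by (simp add: nn_integral_cmult ennreal_mult_less_top)
    finally show ?thesis .
  qed
  \<comment> \<open>A negative coordinate of the normal vector exchanges the two sides of the hyperplane.\<close>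
  define A B where "A = (if 0 < a \<bullet> k then P else Q)" and "B = (if 0 < a \<bullet> k then Q else P)"
  have AB: "0 < A" "0 < B" "1 / A + 1 / B = 1 / P + 1 / Q" using P(2) Q(2) by (auto simp: A_def B_def)
  have side: "(\<integral>\<^sup>+u. F u * indicator S (u k) \<partial>?M) = (\<integral>\<^sup>+x. f x * indicator S ((a \<bullet> x) / (a \<bullet> k)) \<partial>lborel)"
    if [measurable]: "S \<in> sets borel" for S
  proof -
    have "(\<integral>\<^sup>+u. F u * indicator S (u k) \<partial>?M) = (\<integral>\<^sup>+u. f (\<Phi> (V u)) * indicator S ((a \<bullet> \<Phi> (V u)) / (a \<bullet> k)) \<partial>?M)"
      using k(2) by (simp add: F_def aV)
    also have "\<dots> = (\<integral>\<^sup>+x. f x * indicator S ((a \<bullet> x) / (a \<bullet> k)) \<partial>lborel)"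
      by (rule V[of "\<lambda>x. f x * indicator S ((a \<bullet> x) / (a \<bullet> k))"]) measurable
    finally show ?thesis .
  qed
  have A: "(\<integral>\<^sup>+u. F u * indicator {0<..} (u k - c) \<partial>?M) = ennreal A"
  proof -
    have "(\<integral>\<^sup>+u. F u * indicator {0<..} (u k - c) \<partial>?M) = (\<integral>\<^sup>+u. F u * indicator {c<..} (u k) \<partial>?M)"
      by (intro nn_integral_cong) (auto simp: indicator_def)
    also have "\<dots> = (\<integral>\<^sup>+x. f x * indicator {c<..} ((a \<bullet> x) / (a \<bullet> k)) \<partial>lborel)" by (rule side) simp
    also have "\<dots> = (\<integral>\<^sup>+x. f x * indicator (if 0 < a \<bullet> k then {x. b < a \<bullet> x} else {x. a \<bullet> x < b}) x \<partial>lborel)"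
      using k(2) by (intro nn_integral_cong) (auto simp: indicator_def c_def divide_less_cancel)
    finally show ?thesis using P(1) Q(1) by (simp add: A_def split: if_splits)
  qed
  have B: "(\<integral>\<^sup>+u. F u * indicator {0<..} (c - u k) \<partial>?M) = ennreal B"
  proof -
    have "(\<integral>\<^sup>+u. F u * indicator {0<..} (c - u k) \<partial>?M) = (\<integral>\<^sup>+u. F u * indicator {..<c} (u k) \<partial>?M)"
      by (intro nn_integral_cong) (auto simp: indicator_def)
    also have "\<dots> = (\<integral>\<^sup>+x. f x * indicator {..<c} ((a \<bullet> x) / (a \<bullet> k)) \<partial>lborel)" by (rule side) simp
    also have "\<dots> = (\<integral>\<^sup>+x. f x * indicator (if 0 < a \<bullet> k then {x. a \<bullet> x < b} else {x. b < a \<bullet> x}) x \<partial>lborel)"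
      using k(2) by (intro nn_integral_cong) (auto simp: indicator_def c_def divide_less_cancel)
    finally show ?thesis using P(1) Q(1) by (simp add: B_def split: if_splits)
  qed
  obtain \<zeta> where \<zeta>: "\<zeta> k = c" and bound: "\<forall>g\<in>borel_measurable ?M.
      (\<forall>x\<in>space ?M. \<forall>y\<in>space ?M. F x * g y \<le> ennreal (exp (- (\<Sum>i\<in>Basis. (x i - \<zeta> i) * y i)))) \<longrightarrow>
      (\<integral>\<^sup>+y. g y \<partial>?M) \<le> ennreal ((2 * pi) ^ DIM('a) / 4 * (1 / A + 1 / B))"
    using coordinate_hyperplane_santalo[OF I centered_santalo[OF I(1)], unfolded K, OF F moments A AB(1) B AB(2)]
    by blast
  show ?thesis
  proof (intro exI[of _ "\<Phi> (V \<zeta>)"] conjI ballI impI)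
    show "a \<bullet> \<Phi> (V \<zeta>) = b" using k(2) by (simp add: aV \<zeta> c_def)
    fix g :: "'a \<Rightarrow> ennreal" assume g[measurable]: "g \<in> borel_measurable borel"
      and dual: "\<forall>x y. f x * g y \<le> ennreal (exp (- ((x - \<Phi> (V \<zeta>)) \<bullet> y)))"
    have "(\<integral>\<^sup>+y. g y \<partial>lborel) = (\<integral>\<^sup>+v. g (\<Phi> (H v)) \<partial>?M)" using H[OF g] by simp
    also have "\<dots> \<le> ennreal ((2 * pi) ^ DIM('a) / 4 * (1 / A + 1 / B))"
    proof (intro bound[rule_format])
      fix x y :: "'a \<Rightarrow> real"
      show "F x * g (\<Phi> (H y)) \<le> ennreal (exp (- (\<Sum>i\<in>Basis. (x i - \<zeta> i) * y i)))"
        using dual[rule_format, of "\<Phi> (V x)" "\<Phi> (H y)"] unfolding F_def VH .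
    qed measurable
    finally show "(\<integral>\<^sup>+y. g y \<partial>lborel) \<le> ennreal ((2 * pi) ^ DIM('a) / 4 * (1 / P + 1 / Q))"
      unfolding AB(3) .
  qed
qed

section \<open>First moments of log-concave functions\<close>

lemma log_concave_nonneg: "log_concave f \<Longrightarrow> 0 \<le> f x"
  by (auto simp: log_concave_def)

lemma log_concave_convex_combination:
  assumes "log_concave f" "0 \<le> s" "s \<le> 1" "0 < f x" "0 < f y"
  shows "f x powr s * f y powr (1 - s) \<le> f (s *\<^sub>R x + (1 - s) *\<^sub>R y)"
proof -
  obtain \<phi> where \<phi>: "convex_ereal \<phi>" and f: "\<And>x. f x = (if \<phi> x = \<infinity> then 0 else exp (- real_of_ereal (\<phi> x)))"
    using assms(1) by (auto simp: log_concave_def)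
  have fin: "\<exists>u. \<phi> x = ereal u \<and> f x = exp (- u)" if "0 < f x" for x
    using that \<phi> f[of x] by (cases "\<phi> x") (auto simp: convex_ereal_def)
  obtain u v where u: "\<phi> x = ereal u" "f x = exp (- u)" and v: "\<phi> y = ereal v" "f y = exp (- v)"
    using fin[OF assms(4)] fin[OF assms(5)] by auto
  have "\<phi> (s *\<^sub>R x + (1 - s) *\<^sub>R y) \<le> ereal s * \<phi> x + ereal (1 - s) * \<phi> y"
    using \<phi> assms(2,3) by (simp add: convex_ereal_def)
  then have le: "\<phi> (s *\<^sub>R x + (1 - s) *\<^sub>R y) \<le> ereal (s * u + (1 - s) * v)" by (simp add: u v)
  moreover have "\<phi> (s *\<^sub>R x + (1 - s) *\<^sub>R y) \<noteq> -\<infinity>" using \<phi> by (simp add: convex_ereal_def)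
  ultimately obtain w where w: "\<phi> (s *\<^sub>R x + (1 - s) *\<^sub>R y) = ereal w" "w \<le> s * u + (1 - s) * v"
    by (cases "\<phi> (s *\<^sub>R x + (1 - s) *\<^sub>R y)") auto
  have "f x powr s * f y powr (1 - s) = exp (- (s * u + (1 - s) * v))"
    by (simp add: u v powr_def exp_add[symmetric] algebra_simps)
  also have "\<dots> \<le> exp (- w)" using w by simp
  also have "\<dots> = f (s *\<^sub>R x + (1 - s) *\<^sub>R y)" by (simp add: f w)
  finally show ?thesis .
qed

lemma log_concave_level:
  assumes "log_concave f" "0 \<le> s" "s \<le> 1" "0 < m" "m \<le> f x" "m \<le> f y"
  shows "m \<le> f (s *\<^sub>R x + (1 - s) *\<^sub>R y)"
proof -
  have "m = m powr s * m powr (1 - s)" using assms(4) by (simp add: powr_add[symmetric])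
  also have "\<dots> \<le> f x powr s * f y powr (1 - s)" using assms by (intro mult_mono powr_mono2) auto
  also have "\<dots> \<le> f (s *\<^sub>R x + (1 - s) *\<^sub>R y)" using assms by (intro log_concave_convex_combination) auto
  finally show ?thesis .
qed

lemma log_concave_midpoint:
  assumes "log_concave f"
  shows "sqrt (f x * f y) \<le> f ((1 / 2) *\<^sub>R x + (1 / 2) *\<^sub>R y)"
proof (cases "0 < f x \<and> 0 < f y")
  case True
  then show ?thesis
    using log_concave_convex_combination[OF assms, of "1/2" x y] by (simp add: powr_half_sqrt real_sqrt_mult)
next
  case False
  then have "f x = 0 \<or> f y = 0"
    using log_concave_nonneg[OF assms, of x] log_concave_nonneg[OF assms, of y] by linarith
  then have "f x * f y = 0" by auto
  then show ?thesis by (simp only: real_sqrt_zero log_concave_nonneg[OF assms])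
qed

lemma convex_log_concave_superlevel:
  assumes "log_concave f" "0 \<le> t"
  shows "convex {x. t < f x}"
proof (rule convexI)
  fix x y u v assume *: "x \<in> {x. t < f x}" "y \<in> {x. t < f x}" "0 \<le> u" "0 \<le> v" "u + v = (1::real)"
  then have v: "v = 1 - u" and u: "0 \<le> u" "u \<le> 1" and m: "t < min (f x) (f y)" by simp_all
  have "min (f x) (f y) \<le> f (u *\<^sub>R x + (1 - u) *\<^sub>R y)"
    using m assms(2) by (simp_all add: log_concave_level[OF assms(1) u])
  with m have "t < f (u *\<^sub>R x + (1 - u) *\<^sub>R y)" by (rule less_le_trans)
  then show "u *\<^sub>R x + v *\<^sub>R y \<in> {x. t < f x}" unfolding v by simp
qed

text \<open>
  A convex set differs from its closure by a part of its boundary, which is negligible.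
\<close>

lemma convex_sets_lebesgue:
  fixes S :: "'a::euclidean_space set"
  assumes "convex S" shows "S \<in> sets lebesgue"
proof -
  have "negligible (closure S - S)"
    using negligible_convex_frontier[OF assms] by (rule negligible_subset) (use interior_subset in \<open>auto simp: frontier_def\<close>)
  then have "closure S - S \<in> sets lebesgue" by (auto simp: negligible_iff_null_sets)
  moreover have "closure S \<in> sets lebesgue" by (simp add: borel_closed)
  ultimately have "closure S - (closure S - S) \<in> sets lebesgue" by (rule sets.Diff[rotated])
  moreover have "closure S - (closure S - S) = S" using closure_subset[of S] by auto
  ultimately show ?thesis by simp
qed

lemma borel_measurable_log_concave:
  fixes f :: "'a::euclidean_space \<Rightarrow> real"
  assumes "log_concave f" shows "f \<in> borel_measurable lebesgue"
proof (rule borel_measurableI_greater)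
  fix t
  have "{x. t < f x} \<in> sets lebesgue"
  proof (cases "0 \<le> t")
    case True
    then show ?thesis using convex_log_concave_superlevel[OF assms] by (intro convex_sets_lebesgue)
  next
    case False
    then have "t < f x" for x using log_concave_nonneg[OF assms, of x] by linarith
    then have "{x. t < f x} = UNIV" by auto
    then show ?thesis by simp
  qed
  then show "{x \<in> space lebesgue. t < f x} \<in> sets lebesgue" by simp
qed

text \<open>
  Some superlevel set is not negligible, and a convex set that is not negligible has interior points.
\<close>

lemma log_concave_bounded_below_on_ball:
  fixes f :: "'a::euclidean_space \<Rightarrow> real"
  assumes f: "log_concave f" and pos: "0 < (\<integral>\<^sup>+x. ennreal (f x) \<partial>lebesgue)"
  shows "\<exists>a r m. 0 < r \<and> 0 < m \<and> (\<forall>y\<in>ball a r. m \<le> f y)"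
proof -
  have "\<exists>n. \<not> negligible {x. 1 / real (Suc n) < f x}"
  proof (rule ccontr)
    assume "\<nexists>n. \<not> negligible {x. 1 / real (Suc n) < f x}"
    then have "negligible (\<Union>n. {x. 1 / real (Suc n) < f x})" by (intro negligible_countable_Union) auto
    then have "AE x in lebesgue. x \<notin> (\<Union>n. {x. 1 / real (Suc n) < f x})"
      by (intro AE_not_in) (simp only: negligible_iff_null_sets)
    then have "AE x in lebesgue. ennreal (f x) = 0"
    proof eventually_elim
      case (elim x)
      show ?case
      proof (rule ccontr)
        assume "ennreal (f x) \<noteq> 0"
        then have "0 < f x" by (metis ennreal_eq_0_iff not_le)
        then obtain n where "inverse (real (Suc n)) < f x" using reals_Archimedean by blast
        then show False using elim by (auto simp: inverse_eq_divide)
      qed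
    qed
    then have "(\<integral>\<^sup>+x. ennreal (f x) \<partial>lebesgue) = (\<integral>\<^sup>+(x::'a). 0 \<partial>lebesgue)"
      by (rule nn_integral_cong_AE)
    then show False using pos by simp
  qed
  then obtain n where "\<not> negligible {x. 1 / real (Suc n) < f x}" by blast
  then obtain a where "a \<in> interior {x. 1 / real (Suc n) < f x}"
    using convex_log_concave_superlevel[OF f, of "1 / real (Suc n)"] by (auto simp: negligible_convex_interior)
  then obtain r where "0 < r" "ball a r \<subseteq> {x. 1 / real (Suc n) < f x}" by (auto simp: mem_interior)
  then show ?thesis by (intro exI[of _ a] exI[of _ r] exI[of _ "1 / real (Suc n)"]) auto
qed

text \<open>
  On the cone with vertex \<open>x\<close> over the ball around \<open>a\<close>, the half close to the ball contains about
  \<open>norm (x - a) / (2 * r)\<close> disjoint balls of radius \<open>r / 2\<close>. On all of them \<open>f\<close> is at least the minimum of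
  \<open>m\<close> and \<open>sqrt (f x * m)\<close>, by log-concavity. Their number is thus limited by the integral of \<open>f\<close>. The
  square root gives more than the trivial lower bound \<open>f x\<close>, and this gain makes the
  first moment finite.
\<close>

lemma log_concave_radial_decay:
  fixes f :: "'a::euclidean_space \<Rightarrow> real"
  assumes f: "log_concave f" and fin: "(\<integral>\<^sup>+x. ennreal (f x) \<partial>lebesgue) < \<infinity>"
    and r: "0 < r" and m: "0 < m" "\<forall>y\<in>ball a r. m \<le> f y"
  shows "\<exists>C. \<forall>x. norm (x - a) * min (sqrt (f x * m)) m \<le> C"
proof -
  note nonneg = log_concave_nonneg[OF f]
  obtain T where T: "(\<integral>\<^sup>+x. ennreal (f x) \<partial>lborel) = ennreal T" "0 \<le> T"
    using fin by (cases "\<integral>\<^sup>+x. ennreal (f x) \<partial>lebesgue") (auto simp: nn_integral_completion)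
  define V where "V = measure lborel (ball (0::'a) (r / 2))"
  have V: "emeasure lborel (ball c (r / 2)) = ennreal V" for c :: 'a
    unfolding V_def using r by (simp add: emeasure_ball content_ball)
  have "0 < V" unfolding V_def using r by (simp add: content_ball)
  have "norm (x - a) * min (sqrt (f x * m)) m \<le> 2 * r * T / V" for x
  proof (cases "0 < norm (x - a) \<and> 0 < f x")
    case False
    then have "norm (x - a) = 0 \<or> f x = 0" using nonneg[of x] norm_ge_zero[of "x - a"] by linarith
    then have "norm (x - a) * min (sqrt (f x * m)) m = 0" using m(1) by auto
    moreover have "0 \<le> 2 * r * T / V" using r T(2) \<open>0 < V\<close> by simp
    ultimately show ?thesis by linarith
  next
    case True
    define d where "d = norm (x - a)"
    define q where "q = min (sqrt (f x * m)) m"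
    have d: "0 < d" and fx: "0 < f x" using True by (auto simp: d_def)
    have q: "0 < q" "q \<le> m" "q \<le> sqrt (f x * m)" using fx m by (auto simp: q_def)
    \<comment> \<open>The centres below are r apart on the half of the segment from a to x that is closer to a, and N is the number of them that fit there.\<close>
    define N where "N = nat \<lfloor>d / (2 * r)\<rfloor> + 1"
    have N: "d / (2 * r) \<le> real N" unfolding N_def using d r by (simp add: of_nat_nat) linarith
    define \<theta> where "\<theta> j = real j * r / d" for j :: nat
    define c where "c j = a + \<theta> j *\<^sub>R (x - a)" for j
    have \<theta>: "0 \<le> \<theta> j" "\<theta> j \<le> 1 / 2" if "j < N" for j
    proof -
      have "0 \<le> \<lfloor>d / (2 * r)\<rfloor>" using d r by simp
      moreover have "j \<le> nat \<lfloor>d / (2 * r)\<rfloor>" using that unfolding N_def by linarith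
      ultimately have "int j \<le> \<lfloor>d / (2 * r)\<rfloor>" by (simp only: le_nat_iff)
      then have "real j \<le> d / (2 * r)" by (simp add: le_floor_iff)
      then show "0 \<le> \<theta> j" "\<theta> j \<le> 1 / 2" using d r by (auto simp: \<theta>_def field_simps)
    qed
    have ge: "q \<le> f p" if j: "j < N" and p: "p \<in> ball (c j) (r / 2)" for j p
    proof -
      define t where "t = \<theta> j"
      have t: "0 \<le> t" "t \<le> 1 / 2" using \<theta>[OF j] by (auto simp: t_def)
      \<comment> \<open>The point p lies between x and y, and y is in the ball around a.\<close>
      define y where "y = a + (1 / (1 - t)) *\<^sub>R (p - c j)"
      have "norm (p - c j) < r / 2" using p by (simp add: dist_norm norm_minus_commute)
      moreover have "1 / (1 - t) \<le> 2" using t by (simp add: field_simps)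
      ultimately have "(1 / (1 - t)) * norm (p - c j) < 2 * (r / 2)"
        using t by (intro mult_le_less_imp_less) auto
      then have "y \<in> ball a r" using t by (simp add: y_def dist_norm)
      with m(2) have "m \<le> f y" by (rule bspec)
      have "q \<le> sqrt (f x * f y)"
        using q(3) \<open>m \<le> f y\<close> fx by (intro order_trans[OF q(3)] real_sqrt_le_mono mult_left_mono) auto
      then have mid: "q \<le> f ((1 / 2) *\<^sub>R x + (1 / 2) *\<^sub>R y)" using log_concave_midpoint[OF f] by (rule order_trans)
      \<comment> \<open>The point p is also a convex combination of y and of the midpoint of x and y, where f is at least q.\<close>
      have "q \<le> f ((2 * t) *\<^sub>R ((1 / 2) *\<^sub>R x + (1 / 2) *\<^sub>R y) + (1 - 2 * t) *\<^sub>R y)"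
        using t q \<open>m \<le> f y\<close> mid by (simp add: log_concave_level[OF f])
      also have "(2 * t) *\<^sub>R ((1 / 2) *\<^sub>R x + (1 / 2) *\<^sub>R y) + (1 - 2 * t) *\<^sub>R y = t *\<^sub>R x + (1 - t) *\<^sub>R y"
        by (simp add: scaleR_right_distrib scaleR_left_diff_distrib) (simp add: scaleR_2[symmetric] algebra_simps)
      also have "(1 - t) *\<^sub>R y = (1 - t) *\<^sub>R a + (p - c j)"
        using t by (simp add: y_def scaleR_right_distrib)
      also have "t *\<^sub>R x + ((1 - t) *\<^sub>R a + (p - c j)) = p"
        by (simp add: c_def t_def[symmetric] algebra_simps)
      finally show ?thesis .
    qed
    have disj: "disjoint_family_on (\<lambda>j. ball (c j) (r / 2)) {..<N}"
      unfolding disjoint_family_on_def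
    proof (intro ballI impI)
      fix i j :: nat assume "i \<noteq> j"
      have "c i - c j = (\<theta> i - \<theta> j) *\<^sub>R (x - a)" by (simp add: c_def algebra_simps)
      then have "dist (c i) (c j) = \<bar>\<theta> i - \<theta> j\<bar> * d" by (simp add: dist_norm d_def)
      also have "\<theta> i - \<theta> j = (real i - real j) * (r / d)"
        by (simp add: \<theta>_def left_diff_distrib diff_divide_distrib)
      also have "\<bar>(real i - real j) * (r / d)\<bar> * d = \<bar>real i - real j\<bar> * r"
        using d r by (simp add: abs_mult)
      also have "\<dots> \<ge> 1 * r" using \<open>i \<noteq> j\<close> r by (intro mult_right_mono) auto
      finally have "r \<le> dist (c i) (c j)" by simp
      then show "ball (c i) (r / 2) \<inter> ball (c j) (r / 2) = {}"
        by (intro disjoint_ballI) simp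
    qed
    define U where "U = (\<Union>j<N. ball (c j) (r / 2))"
    have Um: "U \<in> sets borel" unfolding U_def by (intro sets.finite_UN) auto
    have "emeasure lborel U = (\<Sum>j<N. emeasure lborel (ball (c j) (r / 2)))"
      unfolding U_def using disj by (intro sum_emeasure[symmetric]) auto
    also have "\<dots> = ennreal (real N * V)"
      using \<open>0 < V\<close> by (simp add: V ennreal_mult ennreal_of_nat_eq_real_of_nat)
    finally have U: "emeasure lborel U = ennreal (real N * V)" .
    have "ennreal (q * (real N * V)) = (\<integral>\<^sup>+p. ennreal q * indicator U p \<partial>lborel)"
      using q(1) \<open>0 < V\<close> by (subst nn_integral_cmult_indicator) (simp_all add: U Um ennreal_mult)
    also have "\<dots> \<le> (\<integral>\<^sup>+p. ennreal (f p) \<partial>lborel)"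
    proof (rule nn_integral_mono)
      fix p show "ennreal q * indicator U p \<le> ennreal (f p)"
        using ge[of _ p] by (auto simp: U_def indicator_def intro!: ennreal_leI)
    qed
    finally have "q * (real N * V) \<le> T" using T by (simp add: ennreal_le_iff)
    moreover have "q * (d / (2 * r) * V) \<le> q * (real N * V)"
      using N q(1) \<open>0 < V\<close> by (intro mult_left_mono mult_right_mono) auto
    ultimately have "q * (d / (2 * r) * V) \<le> T" by linarith
    then have "d * q \<le> 2 * r * T / V" using r \<open>0 < V\<close> by (simp add: field_simps)
    then show ?thesis unfolding d_def q_def .
  qed
  then show ?thesis by blast
qed

lemma nn_integral_lebesgue_affine:
  fixes f :: "'a::euclidean_space \<Rightarrow> ennreal" and t :: 'a
  assumes f[measurable]: "f \<in> borel_measurable lebesgue" and c: "c \<noteq> 0"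
  shows "(\<lambda>x. f (t + c *\<^sub>R x)) \<in> borel_measurable lebesgue"
    and "(\<integral>\<^sup>+x. f x \<partial>lebesgue) = ennreal (\<bar>c\<bar> ^ DIM('a)) * (\<integral>\<^sup>+x. f (t + c *\<^sub>R x) \<partial>lebesgue)"
proof -
  have T: "t + (\<Sum>j\<in>Basis. (c * (x \<bullet> j)) *\<^sub>R j) = t + c *\<^sub>R x" for x :: 'a
    unfolding scaleR_scaleR[symmetric] scaleR_sum_right[symmetric] euclidean_representation ..
  have [measurable]: "(\<lambda>x. t + c *\<^sub>R x) \<in> lebesgue \<rightarrow>\<^sub>M lebesgue"
    using lebesgue_affine_measurable[of "\<lambda>_. c" t] c unfolding T by simp
  then show m: "(\<lambda>x. f (t + c *\<^sub>R x)) \<in> borel_measurable lebesgue" by measurable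
  have "(lebesgue :: 'a measure) = density (distr lebesgue lebesgue (\<lambda>x. t + c *\<^sub>R x)) (\<lambda>_. ennreal (\<bar>c\<bar> ^ DIM('a)))"
    using lebesgue_affine_euclidean[of "\<lambda>_. c" t] c unfolding T by simp
  then have "(\<integral>\<^sup>+x. f x \<partial>lebesgue) = (\<integral>\<^sup>+x. f x \<partial>density (distr lebesgue lebesgue (\<lambda>x. t + c *\<^sub>R x)) (\<lambda>_. ennreal (\<bar>c\<bar> ^ DIM('a))))"
    by simp
  also have "\<dots> = ennreal (\<bar>c\<bar> ^ DIM('a)) * (\<integral>\<^sup>+x. f (t + c *\<^sub>R x) \<partial>lebesgue)"
    using m by (simp add: nn_integral_density nn_integral_distr nn_integral_cmult)
  finally show "(\<integral>\<^sup>+x. f x \<partial>lebesgue) = ennreal (\<bar>c\<bar> ^ DIM('a)) * (\<integral>\<^sup>+x. f (t + c *\<^sub>R x) \<partial>lebesgue)" .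
qed

text \<open>
  Split \<open>f x\<close> as a product of square roots. One of them compensates \<open>norm (x - a)\<close> by the radial decay.
  The other one is bounded, up to a constant, by the value of \<open>f\<close> at the midpoint of \<open>x\<close> and \<open>a\<close>, and a
  dilated copy of \<open>f\<close> is integrable. Where \<open>f x\<close> exceeds \<open>m\<close>, the distance to \<open>a\<close> is bounded.
\<close>

lemma log_concave_first_moment:
  fixes f :: "'a::euclidean_space \<Rightarrow> real"
  assumes f: "log_concave f" and pos: "0 < (\<integral>\<^sup>+x. ennreal (f x) \<partial>lebesgue)"
    and fin: "(\<integral>\<^sup>+x. ennreal (f x) \<partial>lebesgue) < \<infinity>"
  shows "(\<integral>\<^sup>+x. ennreal (f x) * ennreal (norm x) \<partial>lebesgue) < \<infinity>"
proof -
  note nonneg = log_concave_nonneg[OF f]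
  note borel_measurable_log_concave[OF f, measurable]
  from log_concave_bounded_below_on_ball[OF f pos] obtain a r m
    where r: "0 < r" and m: "0 < m" "\<forall>y\<in>ball a r. m \<le> f y" by auto
  from log_concave_radial_decay[OF f fin r m] obtain C
    where C: "norm (x - a) * min (sqrt (f x * m)) m \<le> C" for x by auto
  have "0 \<le> C" using C[of a] by simp
  define g where "g x = f ((1 / 2) *\<^sub>R a + (1 / 2) *\<^sub>R x)" for x
  have g: "sqrt (f x * m) \<le> g x" for x
  proof -
    have "sqrt (f x * m) \<le> sqrt (f a * f x)"
      using bspec[OF m(2), of a] r nonneg[of x] by (simp add: mult.commute mult_right_mono)
    then show ?thesis unfolding g_def using log_concave_midpoint[OF f] by (rule order_trans)
  qed
  have gn: "0 \<le> g x" for x by (simp add: g_def nonneg)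
  have bound: "norm x * f x \<le> (C / m) * g x + (C / m + norm a) * f x" for x
  proof -
    have "norm (x - a) * f x \<le> (C / m) * g x + (C / m) * f x"
    proof (cases "sqrt (f x * m) \<le> m")
      case True
      have "m * (norm (x - a) * f x) = norm (x - a) * sqrt (f x * m) * sqrt (f x * m)"
        using nonneg[of x] m(1) by (simp add: mult.assoc)
      also have "\<dots> \<le> C * g x" using C[of x] True g[of x] nonneg[of x] m(1) \<open>0 \<le> C\<close>
        by (intro mult_mono) (auto simp: min_def split: if_splits)
      finally have "norm (x - a) * f x \<le> (C / m) * g x" using m(1) by (simp add: field_simps)
      moreover have "0 \<le> (C / m) * f x" using \<open>0 \<le> C\<close> m(1) nonneg[of x] by simp
      ultimately show ?thesis by linarith
    next
      case False
      then have "norm (x - a) \<le> C / m" using C[of x] m(1) by (simp add: min_def field_simps)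
      then have "norm (x - a) * f x \<le> (C / m) * f x" using nonneg[of x] by (rule mult_right_mono)
      moreover have "0 \<le> (C / m) * g x" using \<open>0 \<le> C\<close> m(1) gn[of x] by simp
      ultimately show ?thesis by linarith
    qed
    moreover have "norm x \<le> norm (x - a) + norm a" using norm_triangle_ineq[of "x - a" a] by simp
    then have "norm x * f x \<le> (norm (x - a) + norm a) * f x" using nonneg[of x] by (rule mult_right_mono)
    ultimately show ?thesis by (simp add: algebra_simps)
  qed
  have fm: "(\<lambda>x. ennreal (f x)) \<in> borel_measurable lebesgue" by measurable
  have gm[measurable]: "(\<lambda>x. ennreal (g x)) \<in> borel_measurable lebesgue"
    unfolding g_def using nn_integral_lebesgue_affine(1)[OF fm, of "1/2" "(1/2) *\<^sub>R a"] by simp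
  have "(\<integral>\<^sup>+x. ennreal (f x) \<partial>lebesgue) = ennreal ((1 / 2) ^ DIM('a)) * (\<integral>\<^sup>+x. ennreal (g x) \<partial>lebesgue)"
    unfolding g_def using nn_integral_lebesgue_affine(2)[OF fm, of "1/2" "(1/2) *\<^sub>R a"] by simp
  then have g_fin: "(\<integral>\<^sup>+x. ennreal (g x) \<partial>lebesgue) < \<infinity>"
    using fin by (auto simp: ennreal_mult_less_top)
  define K K' where "K = C / m" and "K' = C / m + norm a"
  have K: "0 \<le> K" "0 \<le> K'" using \<open>0 \<le> C\<close> m(1) by (auto simp: K_def K'_def)
  have "(\<integral>\<^sup>+x. ennreal (f x) * ennreal (norm x) \<partial>lebesgue)
    \<le> (\<integral>\<^sup>+x. ennreal K * ennreal (g x) + ennreal K' * ennreal (f x) \<partial>lebesgue)"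
  proof (rule nn_integral_mono)
    fix x
    have "ennreal (f x) * ennreal (norm x) = ennreal (norm x * f x)"
      using nonneg[of x] by (simp add: ennreal_mult mult.commute)
    also have "\<dots> \<le> ennreal (K * g x + K' * f x)" by (rule ennreal_leI[OF bound[folded K_def K'_def]])
    also have "\<dots> = ennreal K * ennreal (g x) + ennreal K' * ennreal (f x)"
      using K nonneg[of x] gn[of x] by (subst ennreal_plus) (auto simp: ennreal_mult)
    finally show "ennreal (f x) * ennreal (norm x) \<le> \<dots>" .
  qed
  also have "\<dots> = ennreal K * (\<integral>\<^sup>+x. ennreal (g x) \<partial>lebesgue) + ennreal K' * (\<integral>\<^sup>+x. ennreal (f x) \<partial>lebesgue)"
    by (subst nn_integral_add) (auto simp: nn_integral_cmult)
  also have "\<dots> < \<infinity>" using fin g_fin by (simp add: ennreal_mult_less_top)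
  finally show ?thesis .
qed

section \<open>Polars and the theorem\<close>

text \<open>
  A Borel representative that stays below \<open>f\<close> everywhere: decreasing a function keeps it
  dual to every function that the original is dual to.
\<close>

lemma lebesgue_borel_minorant:
  fixes f :: "'a::euclidean_space \<Rightarrow> ennreal"
  assumes "f \<in> borel_measurable lebesgue"
  obtains f' where "f' \<in> borel_measurable borel" "\<And>x. f' x \<le> f x" "AE x in lborel. f' x = f x"
proof -
  obtain g where g: "g \<in> borel_measurable lborel" "AE x in lborel. f x = g x"
    using completion_ex_borel_measurable[OF assms] by auto
  then obtain N where N: "N \<in> null_sets lborel" "{x \<in> space lborel. \<not> f x = g x} \<subseteq> N"
    by (auto simp: eventually_ae_filter)
  show ?thesis
  proof (rule that[of "\<lambda>x. g x * indicator (- N) x"])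
    have [measurable]: "N \<in> sets borel" using N(1) by (auto dest: null_setsD2)
    show "(\<lambda>x. g x * indicator (- N) x) \<in> borel_measurable borel" using g(1) by measurable
    show "g x * indicator (- N) x \<le> f x" for x
    proof (cases "x \<in> N")
      case False
      then have "f x = g x" using N(2) by auto
      then show ?thesis by (simp add: indicator_def)
    qed simp
    show "AE x in lborel. g x * indicator (- N) x = f x"
      using AE_not_in[OF N(1)] g(2) by eventually_elim (simp add: indicator_def)
  qed
qed

text \<open>
  The polar is an infimum of continuous functions, hence upper semicontinuous.
\<close>

lemma borel_measurable_polar_at:
  fixes f :: "'a::euclidean_space \<Rightarrow> real"
  shows "polar_at f z \<in> borel_measurable borel"
proof (rule borel_measurableI_less)
  fix t :: ennreal
  let ?h = "\<lambda>x y. ennreal (exp (- ((x - z) \<bullet> (y - z)))) / ennreal (f x)"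
  have "open {y. ?h x y < t}" for x
  proof (cases "0 < f x")
    case True
    then have "?h x = (\<lambda>y. ennreal (exp (- ((x - z) \<bullet> (y - z))) / f x))" by (simp add: divide_ennreal)
    moreover have "continuous_on UNIV (\<lambda>y. ennreal (exp (- ((x - z) \<bullet> (y - z))) / f x))"
      using True by (intro continuous_intros continuous_on_ennreal) auto
    ultimately have "continuous_on UNIV (?h x)" by (simp only:)
    then show ?thesis by (intro open_Collect_less) auto
  next
    case False
    then have "?h x y = \<infinity>" for y by (simp add: ennreal_neg not_less ennreal_divide_eq_top_iff)
    then show ?thesis by simp
  qed
  moreover have "{y. polar_at f z y < t} = (\<Union>x. {y. ?h x y < t})"
    by (auto simp: polar_at_def INF_less_iff)
  ultimately have "open {y. polar_at f z y < t}" by auto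
  then show "{y \<in> space borel. polar_at f z y < t} \<in> sets borel" by simp
qed

lemma mult_polar_at_le:
  assumes "0 \<le> f x"
  shows "ennreal (f x) * polar_at f z y \<le> ennreal (exp (- ((x - z) \<bullet> (y - z))))"
proof (cases "f x = 0")
  case False
  with assms have pos: "0 < f x" by simp
  have "polar_at f z y \<le> ennreal (exp (- ((x - z) \<bullet> (y - z)))) / ennreal (f x)"
    unfolding polar_at_def by (rule INF_lower) simp
  then have "ennreal (f x) * polar_at f z y \<le> ennreal (f x) * (ennreal (exp (- ((x - z) \<bullet> (y - z)))) / ennreal (f x))"
    by (rule mult_left_mono) simp
  also have "\<dots> = ennreal (exp (- ((x - z) \<bullet> (y - z))))"
    using pos by (simp add: divide_ennreal ennreal_mult[symmetric])
  finally show ?thesis .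
qed simp

theorem theorem1p2:
  fixes f :: "real ^ 'n \<Rightarrow> real"
    and H H_plus :: "(real ^ 'n) set"
    and a :: "real ^ 'n" and b lam :: real
  assumes "log_concave f"
    and "0 < (\<integral>\<^sup>+x. ennreal (f x) \<partial>lebesgue)"
    and "(\<integral>\<^sup>+x. ennreal (f x) \<partial>lebesgue) < \<infinity>"
    and "a \<noteq> 0"
    and "H = {x. a \<bullet> x = b}"
    and "H_plus = {x. a \<bullet> x \<ge> b}"
    and "0 < lam" and "lam < 1"
    and "ennreal lam * (\<integral>\<^sup>+x. ennreal (f x) \<partial>lebesgue) = (\<integral>\<^sup>+x\<in>H_plus. ennreal (f x) \<partial>lebesgue)"
  shows "\<exists>z\<in>H. (\<integral>\<^sup>+x. ennreal (f x) \<partial>lebesgue) * (\<integral>\<^sup>+y. polar_at f z y \<partial>lebesgue)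
           \<le> ennreal (1 / (4 * lam * (1 - lam)) * (2 * pi) ^ CARD('n))"
proof -
  have fm: "(\<lambda>x. ennreal (f x)) \<in> borel_measurable lebesgue"
    using borel_measurable_log_concave[OF assms(1)] by measurable
  obtain f' where f'[measurable]: "f' \<in> borel_measurable borel" and f'_le: "\<And>x. f' x \<le> ennreal (f x)"
    and f'_eq: "AE x in lborel. f' x = ennreal (f x)"
    using lebesgue_borel_minorant[OF fm] by blast
  have transfer: "(\<integral>\<^sup>+x. f' x * u x \<partial>lborel) = (\<integral>\<^sup>+x. ennreal (f x) * u x \<partial>lebesgue)" for u
    unfolding nn_integral_completion using f'_eq by (intro nn_integral_cong_AE) (auto elim: eventually_mono)
  obtain M where M: "(\<integral>\<^sup>+x. ennreal (f x) \<partial>lebesgue) = ennreal M" "0 < M"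
    using assms(2,3) by (cases "\<integral>\<^sup>+x. ennreal (f x) \<partial>lebesgue") auto
  define P Q where "P = (\<integral>\<^sup>+x. f' x * indicator {x. b < a \<bullet> x} x \<partial>lborel)"
    and "Q = (\<integral>\<^sup>+x. f' x * indicator {x. a \<bullet> x < b} x \<partial>lborel)"
  have "{x. a \<bullet> x = b} \<in> null_sets lebesgue"
    using negligible_hyperplane[of a b] assms(4) by (simp add: negligible_iff_null_sets)
  then have "{x. a \<bullet> x = b} \<in> null_sets lborel" by (simp add: null_sets_completion_iff)
  then have H: "AE x in lborel. a \<bullet> x \<noteq> b" using AE_not_in by force
  have P: "P = ennreal (lam * M)"
  proof -
    have "P = (\<integral>\<^sup>+x. f' x * indicator H_plus x \<partial>lborel)"
      unfolding P_def assms(6) using H by (intro nn_integral_cong_AE) (auto elim!: eventually_mono simp: indicator_def)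
    also have "\<dots> = ennreal lam * ennreal M"
      unfolding transfer using assms(9) M by simp
    finally show ?thesis using assms(7) M by (simp add: ennreal_mult)
  qed
  have "ennreal M = (\<integral>\<^sup>+x. f' x \<partial>lborel)" using M(1) transfer[of "\<lambda>_. 1"] by simp
  also have "\<dots> = (\<integral>\<^sup>+x. f' x * indicator {x. b < a \<bullet> x} x + f' x * indicator {x. a \<bullet> x < b} x \<partial>lborel)"
    using H by (intro nn_integral_cong_AE) (auto elim!: eventually_mono simp: indicator_def)
  also have "\<dots> = P + Q" unfolding P_def Q_def by (subst nn_integral_add) auto
  finally have "Q = ennreal M - P" using P by simp
  also have "\<dots> = ennreal ((1 - lam) * M)"
    using assms(7) M unfolding P by (subst ennreal_minus) (auto simp: algebra_simps)
  finally have Q: "Q = ennreal ((1 - lam) * M)" .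
  have moment: "(\<integral>\<^sup>+x. f' x * ennreal (norm x) \<partial>lborel) < \<infinity>"
    unfolding transfer by (rule log_concave_first_moment[OF assms(1-3)])
  have "0 < lam * M" "0 < (1 - lam) * M" using assms(7,8) M(2) by auto
  then obtain z where z: "a \<bullet> z = b" and bound: "\<forall>g\<in>borel_measurable borel. (\<forall>x y. f' x * g y \<le> ennreal (exp (- ((x - z) \<bullet> y)))) \<longrightarrow>
      (\<integral>\<^sup>+y. g y \<partial>lborel) \<le> ennreal ((2 * pi) ^ DIM(real ^ 'n) / 4 * (1 / (lam * M) + 1 / ((1 - lam) * M)))"
    using hyperplane_santalo[OF f' moment assms(4) P[unfolded P_def] _ Q[unfolded Q_def]] by blast
  have [measurable]: "polar_at f z \<in> borel_measurable borel" by (rule borel_measurable_polar_at)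
  have "(\<integral>\<^sup>+y. polar_at f z y \<partial>lebesgue) = (\<integral>\<^sup>+y. polar_at f z y \<partial>distr lborel borel ((+) z))"
    by (simp add: nn_integral_completion lborel_distr_plus)
  also have "\<dots> = (\<integral>\<^sup>+y. polar_at f z (z + y) \<partial>lborel)" by (subst nn_integral_distr) auto
  also have "\<dots> \<le> ennreal ((2 * pi) ^ DIM(real ^ 'n) / 4 * (1 / (lam * M) + 1 / ((1 - lam) * M)))"
  proof (intro bound[rule_format])
    fix x y
    have "f' x * polar_at f z (z + y) \<le> ennreal (f x) * polar_at f z (z + y)"
      by (intro mult_right_mono f'_le) simp
    also have "\<dots> \<le> ennreal (exp (- ((x - z) \<bullet> y)))"
      using mult_polar_at_le[of f x z "z + y"] log_concave_nonneg[OF assms(1)] by simp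
    finally show "f' x * polar_at f z (z + y) \<le> ennreal (exp (- ((x - z) \<bullet> y)))" .
  qed measurable
  finally have "(\<integral>\<^sup>+x. ennreal (f x) \<partial>lebesgue) * (\<integral>\<^sup>+y. polar_at f z y \<partial>lebesgue)
    \<le> ennreal M * ennreal ((2 * pi) ^ DIM(real ^ 'n) / 4 * (1 / (lam * M) + 1 / ((1 - lam) * M)))"
    unfolding M(1) by (rule mult_left_mono) simp
  also have "\<dots> = ennreal (M * ((2 * pi) ^ CARD('n) / 4 * (1 / (lam * M) + 1 / ((1 - lam) * M))))"
    using M(2) assms(7,8) by (subst ennreal_mult) auto
  also have "M * ((2 * pi) ^ CARD('n) / 4 * (1 / (lam * M) + 1 / ((1 - lam) * M))) = 1 / (4 * lam * (1 - lam)) * (2 * pi) ^ CARD('n)"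
  proof -
    have "1 / (lam * M) + 1 / ((1 - lam) * M) = 1 / (lam * (1 - lam) * M)"
      using M(2) assms(7,8) by (simp add: field_simps)
    then show ?thesis using M(2) assms(7,8) by simp
  qed
  finally show ?thesis using z assms(5) by auto
qed

end
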